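(* Let $\rho_0\in\mathbb{C}^{m\times m}$ be Hermitian and positive semidefinite with $\mathrm{Tr}(\rho_0)=1$. Let $\rho:[0,T]\to\mathbb{C}^{m\times m}$ be the solution of the Lindblad equation $$\dot\rho(t)=-i[H,\rho(t)]+\sum_{k=1}^K\gamma_k\left(L_k\rho(t)L_k^{\dagger}-\frac12\left\{L_k^{\dagger}L_k,\rho(t)\right\}\right),\qquad \rho(0)=\rho_0,$$ and let $\{\rho_n\}_{n=0}^N$ be the numerical solution generated, starting from $\rho_0$, by the full-rank exponential Euler scheme $$\rho_{n+1}=e^{\tau A}\rho_n e^{\tau A^{\dagger}}+\sum_{k=1}^K\gamma_k\int_0^{\tau}L_k e^{sA}\rho_n e^{sA^{\dagger}}L_k^{\dagger}\,ds,\qquad 0\le n\le N-1.$$ Then $$\|\rho(t_n)-\rho_n\|_1\le c_1\,t_n\,\tau,\qquad 0\le n\le N,$$ where the constant $c_1>0$ depends on $C_1,C_2,T$, but is independent of $\tau$ and $n$.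
   Context: $m,K,N$ are positive integers, $T>0$, $\tau=T/N$, $t_n=n\tau$. $H\in\mathbb{C}^{m\times m}$ is Hermitian; $L_1,\dots,L_K\in\mathbb{C}^{m\times m}$ are arbitrary matrices; $\gamma_1,\dots,\gamma_K\ge0$ are real. The superscript $\dagger$ denotes the conjugate transpose, $[X,Y]=XY-YX$, $\{X,Y\}=XY+YX$, and $$A=-iH-\frac12\sum_{k=1}^K\gamma_kL_k^{\dagger}L_k .$$ For $\varrho\in\mathbb{C}^{m\times m}$, $\|\varrho\|_1=\mathrm{Tr}(\sqrt{\varrho^{\dagger}\varrho})$ is the trace (Schatten-1) norm, i.e. the sum of the singular values. The constants are $C_1=\sum_{k=1}^K\gamma_k\|L_k\|_1^2$ and $C_2=\|A\|_1$. *)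

theory Defs
  imports
    "HOL-Analysis.Henstock_Kurzweil_Integration"
    "Jordan_Normal_Form.Schur_Decomposition"
begin

(* Matrices are the dimension-carrying matrices of Jordan_Normal_Form, so that the size m is an
   ordinary natural number and may be quantified after the error constant.  That library has no
   topology on matrices: exponential, derivative and integral are taken entry by entry.
   The conjugate transpose is the library's mat_adjoint. *)

(* An explicit size is needed for the empty sum. *)
definition mat_sum :: "nat \<Rightarrow> ('k \<Rightarrow> complex mat) \<Rightarrow> 'k set \<Rightarrow> complex mat" where
  "mat_sum m F S = mat m m (\<lambda>(i, j). \<Sum>k\<in>S. F k $$ (i, j))"

definition mat_exp :: "complex mat \<Rightarrow> complex mat" where
  "mat_exp A = mat (dim_row A) (dim_col A)
     (\<lambda>(i, j). \<Sum>p. (A ^\<^sub>m p) $$ (i, j) / fact p)"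

definition has_mat_derivative ::
    "(real \<Rightarrow> complex mat) \<Rightarrow> complex mat \<Rightarrow> real filter \<Rightarrow> bool" where
  "has_mat_derivative F D net \<longleftrightarrow>
     (\<forall>i<dim_row D. \<forall>j<dim_col D.
        ((\<lambda>t. F t $$ (i, j)) has_vector_derivative D $$ (i, j)) net)"

definition mat_integral :: "nat \<Rightarrow> real set \<Rightarrow> (real \<Rightarrow> complex mat) \<Rightarrow> complex mat" where
  "mat_integral m S F = mat m m (\<lambda>(i, j). integral S (\<lambda>s. F s $$ (i, j)))"

definition mat_trace :: "complex mat \<Rightarrow> complex" where
  "mat_trace A = (\<Sum>i<dim_row A. A $$ (i, i))"

definition mat_hermitian :: "complex mat \<Rightarrow> bool" where
  "mat_hermitian A \<longleftrightarrow> mat_adjoint A = A"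

definition mat_psd :: "complex mat \<Rightarrow> bool" where
  "mat_psd A \<longleftrightarrow> mat_hermitian A \<and>
     (\<forall>v\<in>carrier_vec (dim_row A). 0 \<le> Re ((A *\<^sub>v v) \<bullet>c v))"

(* The unique positive semidefinite square root; only meaningful for positive semidefinite A. *)
definition mat_sqrt :: "complex mat \<Rightarrow> complex mat" where
  "mat_sqrt A = (THE B. mat_psd B \<and> B * B = A)"

(* The trace below is real and nonnegative, so Re only changes the type. *)
definition trace_norm :: "complex mat \<Rightarrow> real" where
  "trace_norm A = Re (mat_trace (mat_sqrt (mat_adjoint A * A)))"

definition commutator :: "complex mat \<Rightarrow> complex mat \<Rightarrow> complex mat" where
  "commutator X Y = X * Y - Y * X"

definition anticommutator :: "complex mat \<Rightarrow> complex mat \<Rightarrow> complex mat" where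
  "anticommutator X Y = X * Y + Y * X"

definition drift :: "nat \<Rightarrow> nat \<Rightarrow> complex mat \<Rightarrow> (nat \<Rightarrow> complex mat) \<Rightarrow> (nat \<Rightarrow> real) \<Rightarrow> complex mat"
  where
  "drift m K H L \<gamma> =
     (- \<i>) \<cdot>\<^sub>m H
     - (1/2) \<cdot>\<^sub>m mat_sum m (\<lambda>k. of_real (\<gamma> k) \<cdot>\<^sub>m (mat_adjoint (L k) * L k)) {1..K}"

definition lindblad_rhs ::
    "nat \<Rightarrow> nat \<Rightarrow> complex mat \<Rightarrow> (nat \<Rightarrow> complex mat) \<Rightarrow> (nat \<Rightarrow> real) \<Rightarrow> complex mat \<Rightarrow> complex mat" where
  "lindblad_rhs m K H L \<gamma> R =
     (- \<i>) \<cdot>\<^sub>m commutator H R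
     + mat_sum m (\<lambda>k. of_real (\<gamma> k) \<cdot>\<^sub>m
         (L k * R * mat_adjoint (L k)
          - (1/2) \<cdot>\<^sub>m anticommutator (mat_adjoint (L k) * L k) R)) {1..K}"

definition lindblad_solution ::
    "nat \<Rightarrow> nat \<Rightarrow> complex mat \<Rightarrow> (nat \<Rightarrow> complex mat) \<Rightarrow> (nat \<Rightarrow> real) \<Rightarrow> real
     \<Rightarrow> complex mat \<Rightarrow> (real \<Rightarrow> complex mat) \<Rightarrow> bool" where
  "lindblad_solution m K H L \<gamma> T \<rho>\<^sub>0 \<rho> \<longleftrightarrow>
     \<rho> 0 = \<rho>\<^sub>0 \<and>
     (\<forall>t\<in>{0..T}. \<rho> t \<in> carrier_mat m m \<and>
        has_mat_derivative \<rho> (lindblad_rhs m K H L \<gamma> (\<rho> t)) (at t within {0..T}))"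

definition exp_euler_step ::
    "nat \<Rightarrow> nat \<Rightarrow> complex mat \<Rightarrow> (nat \<Rightarrow> complex mat) \<Rightarrow> (nat \<Rightarrow> real) \<Rightarrow> real
     \<Rightarrow> complex mat \<Rightarrow> complex mat" where
  "exp_euler_step m K H L \<gamma> \<tau> R =
     (let A = drift m K H L \<gamma> in
       mat_exp (of_real \<tau> \<cdot>\<^sub>m A) * R * mat_exp (of_real \<tau> \<cdot>\<^sub>m mat_adjoint A)
       + mat_sum m (\<lambda>k. of_real (\<gamma> k) \<cdot>\<^sub>m
           mat_integral m {0..\<tau>} (\<lambda>s.
             L k * mat_exp (of_real s \<cdot>\<^sub>m A) * R * mat_exp (of_real s \<cdot>\<^sub>m mat_adjoint A)
               * mat_adjoint (L k))) {1..K})"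

end

theory Submission
  imports Defs
begin

text \<open>Write \<open>A\<close> for the drift and \<open>\<L> R = A R + R A\<^sup>* + jump R\<close> for the Lindblad generator, where
  \<open>jump R\<close> is the sum of the \<open>\<gamma>\<^sub>k L\<^sub>k R L\<^sub>k\<^sup>*\<close>.  Regarded as a function of the step length \<open>s\<close>, one step of the scheme from \<open>R\<close>
  is the curve with initial value \<open>R\<close> and derivative \<open>\<L> (X s)\<close>, where \<open>X s = exp (s A) R exp (s A\<^sup>*)\<close>
  (lemma \<open>euler_step_derivative\<close>).  The exact solution has derivative \<open>\<L> (\<rho> (t + s))\<close>, so the difference of the two
  curves has derivative \<open>\<L> (\<rho> (t + s) - X s)\<close>.  Both \<open>\<rho> (t + s)\<close> and \<open>X s\<close> move by \<open>O(\<tau>)\<close> during a step; hence the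
  defect of one step is the old error plus \<open>\<tau>\<close> times a multiple of the old error plus \<open>O(\<tau>\<^sup>2)\<close>
  (lemma \<open>one_step_error\<close>), and a discrete Gronwall argument over at most \<open>T / \<tau>\<close> steps gives the first-order bound
  (lemma \<open>global_error\<close>).  The a priori bounds on \<open>\<rho>\<close> and \<open>X\<close> come from the boundedness of \<open>\<L>\<close> by a
  Gronwall inequality, so the error constant is built from \<open>C\<^sub>1\<close>, \<open>C\<^sub>2\<close> and \<open>T\<close> alone.

  What matters is that all constants are independent of the dimension, so the estimates are carried out in the trace
  norm itself.  It is handled through its dual description as the supremum of \<open>\<bar>tr (W X)\<bar>\<close> over contractions \<open>W\<close>.
  This form is visibly subadditive, satisfies \<open>\<parallel>L X L\<^sup>*\<parallel> \<le> c\<^sup>2 \<parallel>X\<parallel>\<close> when \<open>c\<close> bounds the operator norm of \<open>L\<close>, and turns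
  mean value inequalities for matrix curves into scalar ones.  It is tied to the trace norm by
  \<open>trace_norm_le_dual_norm\<close> (a polar decomposition), by \<open>dual_norm_psd_le\<close> (a density matrix has norm at most one), and by
  \<open>op_bound_trace_norm\<close> (the operator norm is at most the trace norm, which brings in \<open>C\<^sub>1\<close> and \<open>C\<^sub>2\<close>).  These rest on the
  spectral theorem, which is proved by induction on the dimension, and on existence and uniqueness of
  positive semidefinite square roots.\<close>

section \<open>Adjoint, trace and Euclidean norm\<close>

(* The dollar sign is to mean indexing of dimension-carrying vectors only. *)
unbundle no vec_syntax

lemma dim_mat_adjoint [simp]:
  "dim_row (mat_adjoint A) = dim_col A" "dim_col (mat_adjoint A) = dim_row A"
  by (simp_all add: mat_adjoint_def)

lemma index_mat_adjoint [simp]: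
  fixes A :: "complex mat"
  shows "i < dim_col A \<Longrightarrow> j < dim_row A \<Longrightarrow> mat_adjoint A $$ (i, j) = cnj (A $$ (j, i))"
  by (simp add: mat_adjoint_def mat_of_rows_index)

lemma mat_adjoint_carrier [simp]: "A \<in> carrier_mat n k \<Longrightarrow> mat_adjoint A \<in> carrier_mat k n"
  unfolding carrier_mat_def by simp

lemma mat_adjoint_adjoint [simp]:
  fixes A :: "complex mat"
  shows "mat_adjoint (mat_adjoint A) = A"
  by (rule eq_matI) auto

lemma square_mat_closed [simp]:
  "A \<in> carrier_mat n n \<Longrightarrow> B \<in> carrier_mat n n \<Longrightarrow> A * B \<in> carrier_mat n n"
  by (rule mult_carrier_mat)

lemma square_mat_mult_vec_closed [simp]:
  "A \<in> carrier_mat n n \<Longrightarrow> v \<in> carrier_vec n \<Longrightarrow> A *\<^sub>v v \<in> carrier_vec n"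
  by (rule mult_mat_vec_carrier)

lemma square_mat_assoc:
  "A \<in> carrier_mat n n \<Longrightarrow> B \<in> carrier_mat n n \<Longrightarrow> C \<in> carrier_mat n n
    \<Longrightarrow> A * B * C = A * (B * C)"
  by (rule assoc_mult_mat)

lemma square_mat_minus_closed [simp]:
  "A \<in> carrier_mat n n \<Longrightarrow> B \<in> carrier_mat n n \<Longrightarrow> A - B \<in> carrier_mat n n"
  by (rule minus_carrier_mat)

lemma index_mult_mat_sum:
  assumes "A \<in> carrier_mat n k" "B \<in> carrier_mat k p" "i < n" "j < p"
  shows "(A * B) $$ (i, j) = (\<Sum>l<k. A $$ (i, l) * B $$ (l, j))"
  using assms by (simp add: scalar_prod_def atLeast0LessThan)

lemma index_mult_mat_vec_sum:
  assumes "A \<in> carrier_mat n k" "v \<in> carrier_vec k" "i < n"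
  shows "(A *\<^sub>v v) $ i = (\<Sum>l<k. A $$ (i, l) * v $ l)"
  using assms by (simp add: scalar_prod_def atLeast0LessThan)

lemma mat_adjoint_mult:
  fixes A :: "complex mat"
  assumes "A \<in> carrier_mat n k" "B \<in> carrier_mat k p"
  shows "mat_adjoint (A * B) = mat_adjoint B * mat_adjoint A"
proof (rule eq_matI)
  fix i j assume "i < dim_row (mat_adjoint B * mat_adjoint A)"
    and "j < dim_col (mat_adjoint B * mat_adjoint A)"
  hence ij: "i < p" "j < n" using assms by auto
  have "(mat_adjoint B * mat_adjoint A) $$ (i, j)
      = (\<Sum>l<k. mat_adjoint B $$ (i, l) * mat_adjoint A $$ (l, j))"
    by (rule index_mult_mat_sum) (use assms ij in auto)
  also have "\<dots> = (\<Sum>l<k. cnj (A $$ (j, l) * B $$ (l, i)))"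
    by (rule sum.cong) (use assms ij in \<open>auto simp: mult.commute\<close>)
  finally show "mat_adjoint (A * B) $$ (i, j) = (mat_adjoint B * mat_adjoint A) $$ (i, j)"
    using assms ij by (simp add: index_mult_mat_sum[OF assms] del: index_mult_mat(1))
qed (use assms in auto)

lemma mat_adjoint_minus:
  fixes A :: "complex mat"
  assumes "A \<in> carrier_mat n k" "B \<in> carrier_mat n k"
  shows "mat_adjoint (A - B) = mat_adjoint A - mat_adjoint B"
  using assms by (intro eq_matI) auto

lemma mat_adjoint_smult:
  fixes A :: "complex mat"
  shows "mat_adjoint (c \<cdot>\<^sub>m A) = cnj c \<cdot>\<^sub>m mat_adjoint A"
  by (intro eq_matI) auto

lemma mat_adjoint_one [simp]: "mat_adjoint (1\<^sub>m n :: complex mat) = 1\<^sub>m n"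
  by (intro eq_matI) auto

lemma mat_trace_eq: "A \<in> carrier_mat n n \<Longrightarrow> mat_trace A = (\<Sum>i<n. A $$ (i, i))"
  by (simp add: mat_trace_def)

lemma mat_trace_mult:
  assumes "A \<in> carrier_mat n k" "B \<in> carrier_mat k n"
  shows "mat_trace (A * B) = (\<Sum>i<n. \<Sum>l<k. A $$ (i, l) * B $$ (l, i))"
proof -
  have "mat_trace (A * B) = (\<Sum>i<n. (A * B) $$ (i, i))"
    using assms by (simp add: mat_trace_def)
  also have "\<dots> = (\<Sum>i<n. \<Sum>l<k. A $$ (i, l) * B $$ (l, i))"
    by (intro sum.cong index_mult_mat_sum[OF assms]) auto
  finally show ?thesis .
qed

lemma mat_trace_commute:
  assumes "A \<in> carrier_mat n k" "B \<in> carrier_mat k n"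
  shows "mat_trace (A * B) = mat_trace (B * A)"
  unfolding mat_trace_mult[OF assms] mat_trace_mult[OF assms(2,1)]
  by (subst sum.swap) (simp add: mult.commute)

lemma mat_trace_add:
  assumes "A \<in> carrier_mat n n" "B \<in> carrier_mat n n"
  shows "mat_trace (A + B) = mat_trace A + mat_trace B"
  using assms by (simp add: mat_trace_def sum.distrib)

lemma mat_trace_smult: "A \<in> carrier_mat n n \<Longrightarrow> mat_trace (c \<cdot>\<^sub>m A) = c * mat_trace A"
  by (simp add: mat_trace_def sum_distrib_left)

definition vnorm :: "complex vec \<Rightarrow> real" where
  "vnorm v = L2_set (\<lambda>i. cmod (v $ i)) {..<dim_vec v}"

lemma vnorm_nonneg [simp]: "0 \<le> vnorm v"
  by (simp add: vnorm_def)

lemma cscalar_prod_sum: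
  fixes v w :: "complex vec"
  assumes "v \<in> carrier_vec n" "w \<in> carrier_vec n"
  shows "v \<bullet>c w = (\<Sum>i<n. v $ i * cnj (w $ i))"
  using assms by (simp add: scalar_prod_def atLeast0LessThan)

lemma vnorm_sq: "(vnorm v)\<^sup>2 = Re (v \<bullet>c v)"
proof -
  have "(vnorm v)\<^sup>2 = (\<Sum>i<dim_vec v. (cmod (v $ i))\<^sup>2)"
    unfolding vnorm_def L2_set_def by (simp add: sum_nonneg)
  also have "\<dots> = Re (v \<bullet>c v)"
    by (subst cscalar_prod_sum[of _ "dim_vec v"])
      (auto simp flip: complex_norm_square power2_eq_square intro!: sum.cong)
  finally show ?thesis .
qed

lemma cscalar_prod_self: "v \<bullet>c v = complex_of_real ((vnorm v)\<^sup>2)"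
proof -
  have "Im (v \<bullet>c v) = 0"
    by (subst cscalar_prod_sum[of _ "dim_vec v"]) (auto intro!: sum.neutral)
  thus ?thesis by (simp add: vnorm_sq complex_eq_iff)
qed

lemma norm_cscalar_prod_le:
  assumes "v \<in> carrier_vec n" "w \<in> carrier_vec n"
  shows "cmod (v \<bullet>c w) \<le> vnorm v * vnorm w"
proof -
  have "cmod (v \<bullet>c w) \<le> (\<Sum>i<n. \<bar>cmod (v $ i)\<bar> * \<bar>cmod (w $ i)\<bar>)"
    unfolding cscalar_prod_sum[OF assms] by (rule sum_norm_le) (simp add: norm_mult)
  also have "\<dots> \<le> vnorm v * vnorm w"
    using L2_set_mult_ineq[of "\<lambda>i. cmod (v $ i)" "\<lambda>i. cmod (w $ i)" "{..<n}"] assms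
    by (simp add: vnorm_def)
  finally show ?thesis .
qed

lemma norm_index_le_vnorm: "i < dim_vec v \<Longrightarrow> cmod (v $ i) \<le> vnorm v"
  unfolding vnorm_def by (rule member_le_L2_set) auto

lemma vnorm_smult: "vnorm (c \<cdot>\<^sub>v v) = cmod c * vnorm v"
proof -
  have "vnorm (c \<cdot>\<^sub>v v) = L2_set (\<lambda>i. cmod c * cmod (v $ i)) {..<dim_vec v}"
    unfolding vnorm_def by (intro L2_set_cong) (auto simp: norm_mult)
  thus ?thesis by (simp add: vnorm_def L2_set_right_distrib)
qed

lemma vnorm_unit_vec: "j < n \<Longrightarrow> vnorm (unit_vec n j) = 1"
proof -
  assume j: "j < n"
  have "(vnorm (unit_vec n j))\<^sup>2 = 1"
    unfolding vnorm_sq cscalar_prod_sum[OF unit_vec_carrier unit_vec_carrier]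
    using j by (simp add: if_distrib cong: if_cong)
  thus ?thesis by (simp add: power2_eq_1_iff) (metis vnorm_nonneg not_one_le_zero neg_0_le_iff_le)
qed

lemma cscalar_prod_mult_mat_vec:
  fixes A :: "complex mat"
  assumes "A \<in> carrier_mat n k" "v \<in> carrier_vec k" "w \<in> carrier_vec n"
  shows "(A *\<^sub>v v) \<bullet>c w = v \<bullet>c (mat_adjoint A *\<^sub>v w)"
proof -
  have "(A *\<^sub>v v) \<bullet>c w = (\<Sum>i<n. \<Sum>l<k. A $$ (i, l) * v $ l * cnj (w $ i))"
    using assms by (subst cscalar_prod_sum[of _ n])
      (auto simp: index_mult_mat_vec_sum sum_distrib_right simp del: index_mult_mat_vec intro!: sum.cong)
  also have "\<dots> = (\<Sum>l<k. \<Sum>i<n. A $$ (i, l) * v $ l * cnj (w $ i))"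
    by (rule sum.swap)
  also have "\<dots> = v \<bullet>c (mat_adjoint A *\<^sub>v w)"
    using assms by (subst cscalar_prod_sum[of _ k])
      (auto simp: index_mult_mat_vec_sum[of _ k n] sum_distrib_left mult_ac simp del: index_mult_mat_vec intro!: sum.cong
        mult_mat_vec_carrier)
  finally show ?thesis .
qed

section \<open>Bounds on the operator norm\<close>

text \<open>The operator norm enters only through upper bounds, so it is used as a relation
  between a matrix and a bound.\<close>
definition op_bound :: "nat \<Rightarrow> complex mat \<Rightarrow> real \<Rightarrow> bool" where
  "op_bound n W c \<longleftrightarrow> W \<in> carrier_mat n n \<and> 0 \<le> c \<and>
     (\<forall>v\<in>carrier_vec n. vnorm (W *\<^sub>v v) \<le> c * vnorm v)"

lemma op_bound_carrier: "op_bound n W c \<Longrightarrow> W \<in> carrier_mat n n"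
  and op_bound_nonneg: "op_bound n W c \<Longrightarrow> 0 \<le> c"
  and op_boundD: "op_bound n W c \<Longrightarrow> v \<in> carrier_vec n \<Longrightarrow> vnorm (W *\<^sub>v v) \<le> c * vnorm v"
  by (auto simp: op_bound_def)

lemma op_bound_mult:
  assumes "op_bound n A a" "op_bound n B b"
  shows "op_bound n (A * B) (a * b)"
  unfolding op_bound_def
proof (intro conjI ballI)
  note c = op_bound_carrier[OF assms(1)] op_bound_carrier[OF assms(2)]
  show "A * B \<in> carrier_mat n n" using c by simp
  show "0 \<le> a * b" using op_bound_nonneg assms by (metis mult_nonneg_nonneg)
  fix v :: "complex vec" assume v: "v \<in> carrier_vec n"
  have "vnorm (A * B *\<^sub>v v) = vnorm (A *\<^sub>v (B *\<^sub>v v))" using c v by simp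
  also have "\<dots> \<le> a * vnorm (B *\<^sub>v v)" by (rule op_boundD[OF assms(1)]) (use c v in simp)
  also have "\<dots> \<le> a * (b * vnorm v)"
    by (intro mult_left_mono op_boundD[OF assms(2)] v op_bound_nonneg[OF assms(1)])
  finally show "vnorm (A * B *\<^sub>v v) \<le> a * b * vnorm v" by simp
qed

lemma op_bound_adjoint:
  assumes "op_bound n A a"
  shows "op_bound n (mat_adjoint A) a"
  unfolding op_bound_def
proof (intro conjI ballI)
  note c = op_bound_carrier[OF assms]
  show "mat_adjoint A \<in> carrier_mat n n" using c by simp
  show "0 \<le> a" using op_bound_nonneg assms .
  fix v :: "complex vec" assume v: "v \<in> carrier_vec n"
  let ?w = "mat_adjoint A *\<^sub>v v"
  have w: "?w \<in> carrier_vec n" using c v by (auto intro!: mult_mat_vec_carrier)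
  have "(vnorm ?w)\<^sup>2 = cmod (?w \<bullet>c ?w)"
    by (simp add: cscalar_prod_self norm_power del: of_real_power)
  also have "?w \<bullet>c ?w = v \<bullet>c (A *\<^sub>v ?w)"
    using cscalar_prod_mult_mat_vec[of "mat_adjoint A" n n v ?w] c v w by simp
  also have "cmod \<dots> \<le> vnorm v * vnorm (A *\<^sub>v ?w)"
    by (rule norm_cscalar_prod_le[OF v]) (use c w in simp)
  also have "\<dots> \<le> vnorm v * (a * vnorm ?w)"
    by (intro mult_left_mono op_boundD[OF assms w]) simp
  finally have "vnorm ?w * vnorm ?w \<le> (a * vnorm v) * vnorm ?w"
    by (simp add: power2_eq_square mult_ac)
  thus "vnorm ?w \<le> a * vnorm v"
    using op_bound_nonneg[OF assms]
    by (cases "vnorm ?w = 0") (auto simp: less_le intro: mult_right_le_imp_le)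
qed

lemma op_bound_smult:
  assumes "op_bound n A a"
  shows "op_bound n (c \<cdot>\<^sub>m A) (cmod c * a)"
  unfolding op_bound_def
proof (intro conjI ballI)
  note cA = op_bound_carrier[OF assms]
  show "c \<cdot>\<^sub>m A \<in> carrier_mat n n" "0 \<le> cmod c * a" using cA op_bound_nonneg[OF assms] by auto
  fix v :: "complex vec" assume v: "v \<in> carrier_vec n"
  have "c \<cdot>\<^sub>m A *\<^sub>v v = c \<cdot>\<^sub>v (A *\<^sub>v v)" using cA v by (intro eq_vecI) auto
  thus "vnorm (c \<cdot>\<^sub>m A *\<^sub>v v) \<le> cmod c * a * vnorm v"
    using mult_left_mono[OF op_boundD[OF assms v], of "cmod c"]
    by (simp add: vnorm_smult mult_ac)
qed

lemma op_bound_index_le: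
  assumes "op_bound n A a" "i < n" "j < n"
  shows "cmod (A $$ (i, j)) \<le> a"
proof -
  note c = op_bound_carrier[OF assms(1)]
  have "A $$ (i, j) = (A *\<^sub>v unit_vec n j) $ i"
    using c assms by (simp add: scalar_prod_right_unit)
  hence "cmod (A $$ (i, j)) \<le> vnorm (A *\<^sub>v unit_vec n j)"
    using c assms norm_index_le_vnorm[of i "A *\<^sub>v unit_vec n j"] by simp
  also have "\<dots> \<le> a * vnorm (unit_vec n j)" by (rule op_boundD[OF assms(1)]) simp
  finally show ?thesis using assms by (simp add: vnorm_unit_vec)
qed

lemma op_bound_one: "op_bound n (1\<^sub>m n) 1"
  by (simp add: op_bound_def)

section \<open>The spectral theorem\<close>

definition real_diag :: "nat \<Rightarrow> (nat \<Rightarrow> real) \<Rightarrow> complex mat" where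
  "real_diag n d = mat n n (\<lambda>(i, j). if i = j then complex_of_real (d i) else 0)"

lemma real_diag_carrier [simp]: "real_diag n d \<in> carrier_mat n n"
  and dim_real_diag [simp]: "dim_row (real_diag n d) = n" "dim_col (real_diag n d) = n"
  by (simp_all add: real_diag_def)

lemma real_diag_adjoint [simp]: "mat_adjoint (real_diag n d) = real_diag n d"
  by (rule eq_matI) (auto simp: real_diag_def)

lemma real_diag_mult: "real_diag n d * real_diag n e = real_diag n (\<lambda>i. d i * e i)"
proof (rule eq_matI)
  fix i j assume "i < dim_row (real_diag n (\<lambda>i. d i * e i))"
    and "j < dim_col (real_diag n (\<lambda>i. d i * e i))"
  hence ij: "i < n" "j < n" by auto
  show "(real_diag n d * real_diag n e) $$ (i, j) = real_diag n (\<lambda>i. d i * e i) $$ (i, j)"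
    using ij by (subst index_mult_mat_sum[of _ n n _ n])
      (auto simp: real_diag_def if_distrib[of "\<lambda>x. x * _"] cong: if_cong)
qed auto

lemma real_diag_mult_vec:
  assumes "v \<in> carrier_vec n"
  shows "real_diag n d *\<^sub>v v = vec n (\<lambda>i. complex_of_real (d i) * v $ i)"
proof (rule eq_vecI)
  fix i assume "i < dim_vec (vec n (\<lambda>i. complex_of_real (d i) * v $ i))"
  hence i: "i < n" by simp
  show "(real_diag n d *\<^sub>v v) $ i = vec n (\<lambda>i. complex_of_real (d i) * v $ i) $ i"
    using i assms by (subst index_mult_mat_vec_sum[of _ n n])
      (auto simp: real_diag_def if_distrib[of "\<lambda>x. x * _"] cong: if_cong)
qed auto

lemma op_bound_real_diag:
  assumes "\<And>i. i < n \<Longrightarrow> \<bar>d i\<bar> \<le> c" "0 \<le> c"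
  shows "op_bound n (real_diag n d) c"
  unfolding op_bound_def
proof (intro conjI ballI)
  fix v :: "complex vec" assume v: "v \<in> carrier_vec n"
  have "vnorm (real_diag n d *\<^sub>v v) = L2_set (\<lambda>i. \<bar>d i\<bar> * cmod (v $ i)) {..<n}"
    unfolding real_diag_mult_vec[OF v] vnorm_def by (intro L2_set_cong) (auto simp: norm_mult)
  also have "\<dots> \<le> L2_set (\<lambda>i. c * cmod (v $ i)) {..<n}"
    using assms by (intro L2_set_mono mult_right_mono) auto
  also have "\<dots> = c * vnorm v" using v assms by (simp add: vnorm_def L2_set_right_distrib)
  finally show "vnorm (real_diag n d *\<^sub>v v) \<le> c * vnorm v" .
qed (use assms in auto)

lemma vnorm_unitary:
  assumes "U \<in> carrier_mat n n" "mat_adjoint U * U = 1\<^sub>m n" "v \<in> carrier_vec n"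
  shows "vnorm (U *\<^sub>v v) = vnorm v"
proof -
  have Uv: "U *\<^sub>v v \<in> carrier_vec n" using assms by (auto intro: mult_mat_vec_carrier)
  have "mat_adjoint U *\<^sub>v (U *\<^sub>v v) = v"
    using assms by (subst assoc_mult_mat_vec[symmetric, of _ n n _ n]) auto
  hence "(U *\<^sub>v v) \<bullet>c (U *\<^sub>v v) = v \<bullet>c v"
    using cscalar_prod_mult_mat_vec[OF assms(1,3) Uv] by simp
  hence "(vnorm (U *\<^sub>v v))\<^sup>2 = (vnorm v)\<^sup>2" by (simp add: vnorm_sq)
  thus ?thesis by simp
qed

text \<open>Gram-Schmidt applied to a basis that starts with \<open>v\<close> keeps \<open>v\<close> as its first vector but does not
  normalise; dividing the resulting orthogonal columns by their lengths gives the unitary matrix.\<close>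
lemma unitary_with_first_col:
  assumes v: "v \<in> carrier_vec n" and v0: "(v :: complex vec) \<noteq> 0\<^sub>v n"
  obtains U where "U \<in> carrier_mat n n" "mat_adjoint U * U = 1\<^sub>m n"
    "col U 0 = complex_of_real (1 / vnorm v) \<cdot>\<^sub>v v"
proof -
  interpret cof_vec_space n "TYPE(complex)" .
  have n: "0 < n" using v v0 by (cases n) auto
  define b where "b = basis_completion v"
  define ws where "ws = gram_schmidt n b"
  note bc = basis_completion[OF v v0, folded b_def]
  from gram_schmidt_result[OF bc(2) bc(4) bc(5) ws_def] bc(6)
  have ws: "set ws \<subseteq> carrier_vec n" "corthogonal ws" "length ws = n" by auto
  obtain vs where "b = v # vs" using bc(6,7) n by (cases b) auto
  hence hd: "hd ws = v" using gram_schmidt_hd[OF v, of vs] by (simp add: ws_def)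
  have car: "ws ! j \<in> carrier_vec n" if "j < n" for j using ws that by auto
  have nz: "vnorm (ws ! j) \<noteq> 0" if j: "j < n" for j
  proof
    assume "vnorm (ws ! j) = 0"
    hence "ws ! j \<bullet>c ws ! j = 0" by (simp add: cscalar_prod_self)
    thus False using corthogonalD[OF ws(2), of j j] j ws(3) by simp
  qed
  define U where "U = mat n n (\<lambda>(i, j). complex_of_real (1 / vnorm (ws ! j)) * ws ! j $ i)"
  have U: "U \<in> carrier_mat n n" by (simp add: U_def)
  have "mat_adjoint U * U = 1\<^sub>m n"
  proof (rule eq_matI)
    fix i j assume "i < dim_row (1\<^sub>m n)" "j < dim_col (1\<^sub>m n)"
    hence ij: "i < n" "j < n" by auto
    have "(mat_adjoint U * U) $$ (i, j)
        = (\<Sum>l<n. complex_of_real (1 / vnorm (ws ! i) * (1 / vnorm (ws ! j)))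
                 * (ws ! j $ l * cnj (ws ! i $ l)))"
      using ij by (subst index_mult_mat_sum[of _ n n _ n]) (auto simp: U_def mult_ac)
    also have "\<dots> = complex_of_real (1 / vnorm (ws ! i) * (1 / vnorm (ws ! j))) * (ws ! j \<bullet>c ws ! i)"
      unfolding cscalar_prod_sum[OF car[OF ij(2)] car[OF ij(1)]] by (simp add: sum_distrib_left)
    also have "\<dots> = 1\<^sub>m n $$ (i, j)"
    proof (cases "i = j")
      case True
      thus ?thesis using ij nz[of i] by (simp add: cscalar_prod_self power2_eq_square)
    next
      case False
      thus ?thesis using ij corthogonalD[OF ws(2), of j i] ws(3) by simp
    qed
    finally show "(mat_adjoint U * U) $$ (i, j) = 1\<^sub>m n $$ (i, j)" .
  qed (use U in auto)
  moreover have "col U 0 = complex_of_real (1 / vnorm v) \<cdot>\<^sub>v v"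
  proof -
    have "ws ! 0 = v" using hd ws(3) n by (metis hd_conv_nth length_greater_0_conv)
    thus ?thesis using n v by (intro eq_vecI) (auto simp: U_def)
  qed
  ultimately show ?thesis using that U by blast
qed

lemma complex_eigenvector_exists:
  assumes A: "(A :: complex mat) \<in> carrier_mat n n" and n: "0 < n"
  obtains v e where "v \<in> carrier_vec n" "v \<noteq> 0\<^sub>v n" "A *\<^sub>v v = e \<cdot>\<^sub>v v"
proof -
  have "degree (char_poly A) = n" using degree_monic_char_poly[OF A] by simp
  hence "\<not> constant (poly (char_poly A))" using n by (simp add: constant_degree)
  then obtain e where "poly (char_poly A) e = 0"
    using fundamental_theorem_of_algebra by blast
  hence "eigenvalue A e" using eigenvalue_root_char_poly[OF A] by simp
  then obtain v where "eigenvector A v e" unfolding eigenvalue_def by blast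
  thus ?thesis using that A unfolding eigenvector_def by auto
qed

lemma mat_adjoint_zero [simp]: "mat_adjoint (0\<^sub>m a b :: complex mat) = 0\<^sub>m b a"
  by (intro eq_matI) auto

lemma mat_adjoint_four_block:
  fixes A :: "complex mat"
  assumes "A \<in> carrier_mat a b" "B \<in> carrier_mat a c" "C \<in> carrier_mat d b" "D \<in> carrier_mat d c"
  shows "mat_adjoint (four_block_mat A B C D)
    = four_block_mat (mat_adjoint A) (mat_adjoint C) (mat_adjoint B) (mat_adjoint D)"
  using assms by (intro eq_matI) auto

text \<open>Induction on the dimension.  If the first column of the unitary \<open>U\<close> is an eigenvector of \<open>A\<close>, the first
  column of \<open>B = U\<^sup>* A U\<close> is zero below the diagonal; being Hermitian, \<open>B\<close> is then block diagonal, and the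
  remaining block \<open>C\<close> is diagonalised by the induction hypothesis.\<close>
lemma hermitian_spectral_decomposition:
  assumes "A \<in> carrier_mat n n" "mat_hermitian A"
  obtains V d where "V \<in> carrier_mat n n" "mat_adjoint V * V = 1\<^sub>m n"
    "A = V * real_diag n d * mat_adjoint V"
proof -
  have "\<exists>V d. V \<in> carrier_mat n n \<and> mat_adjoint V * V = 1\<^sub>m n \<and> mat_adjoint V * A * V = real_diag n d"
    using assms
  proof (induction n arbitrary: A)
    case 0
    thus ?case by (intro exI[of _ "1\<^sub>m 0"] exI) (auto intro!: eq_matI)
  next
    case (Suc n A)
    note A = Suc.prems(1)
    have Aherm: "mat_adjoint A = A" using Suc.prems(2) by (simp add: mat_hermitian_def)
    obtain v e where v: "v \<in> carrier_vec (Suc n)" "v \<noteq> 0\<^sub>v (Suc n)" "A *\<^sub>v v = e \<cdot>\<^sub>v v"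
      using complex_eigenvector_exists[OF A] by blast
    obtain U where U: "U \<in> carrier_mat (Suc n) (Suc n)" "mat_adjoint U * U = 1\<^sub>m (Suc n)"
      and col0: "col U 0 = complex_of_real (1 / vnorm v) \<cdot>\<^sub>v v"
      using unitary_with_first_col[OF v(1,2)] by metis
    define B where "B = mat_adjoint U * A * U"
    have B: "B \<in> carrier_mat (Suc n) (Suc n)" using A U by (simp add: B_def)
    have Bherm: "mat_adjoint B = B"
      unfolding B_def using A U
      by (simp add: mat_adjoint_mult[of _ "Suc n" "Suc n" _ "Suc n"] Aherm square_mat_assoc[of _ "Suc n"])
    have "col (A * U) 0 = e \<cdot>\<^sub>v col U 0"
    proof -
      have "col (A * U) 0 = A *\<^sub>v col U 0" using A U by (intro eq_vecI) auto
      also have "\<dots> = complex_of_real (1 / vnorm v) \<cdot>\<^sub>v (A *\<^sub>v v)"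
        unfolding col0 using A v by (simp add: mult_mat_vec)
      also have "\<dots> = e \<cdot>\<^sub>v col U 0" unfolding v(3) col0 by (simp add: smult_smult_assoc mult.commute)
      finally show ?thesis .
    qed
    hence AU: "(A * U) $$ (l, 0) = e * U $$ (l, 0)" if "l < Suc n" for l
      using that A U by (auto dest!: arg_cong[of _ _ "\<lambda>w. w $ l"])
    have Bi0: "B $$ (i, 0) = (if i = 0 then e else 0)" if i: "i < Suc n" for i
    proof -
      have "B = mat_adjoint U * (A * U)" unfolding B_def using A U by (simp add: square_mat_assoc[of _ "Suc n"])
      hence "B $$ (i, 0) = (\<Sum>l<Suc n. mat_adjoint U $$ (i, l) * (A * U) $$ (l, 0))"
        using A U i by (simp only:) (rule index_mult_mat_sum, auto)
      also have "\<dots> = e * (\<Sum>l<Suc n. mat_adjoint U $$ (i, l) * U $$ (l, 0))"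
        unfolding sum_distrib_left by (intro sum.cong) (auto simp: AU mult_ac)
      also have "(\<Sum>l<Suc n. mat_adjoint U $$ (i, l) * U $$ (l, 0)) = (mat_adjoint U * U) $$ (i, 0)"
        using U(1) i by (intro index_mult_mat_sum[symmetric]) auto
      finally show ?thesis unfolding U(2) using i by simp
    qed
    have B0j: "B $$ (0, j) = (if j = 0 then cnj e else 0)" if j: "j < Suc n" for j
    proof -
      have "B $$ (0, j) = cnj (B $$ (j, 0))"
        using B j by (subst Bherm[symmetric]) simp
      thus ?thesis using Bi0[OF j] by simp
    qed
    \<comment> \<open>The corner entry equals its own conjugate, so the eigenvalue is real.\<close>
    have "B $$ (0, 0) = e" using Bi0[of 0] by simp
    moreover have "B $$ (0, 0) = cnj e" using B0j[of 0] by simp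
    ultimately have ce: "cnj e = e" by metis
    have "Im e = 0" using arg_cong[OF ce, of Im] by simp
    hence e: "complex_of_real (Re e) = e" by (simp add: complex_eq_iff)
    define C where "C = mat n n (\<lambda>(i, j). B $$ (Suc i, Suc j))"
    have C: "C \<in> carrier_mat n n" by (simp add: C_def)
    have Cherm: "mat_hermitian C" unfolding mat_hermitian_def
    proof (rule eq_matI)
      fix i j assume "i < dim_row C" "j < dim_col C"
      hence ij: "i < n" "j < n" using C by auto
      have "mat_adjoint B $$ (Suc i, Suc j) = B $$ (Suc i, Suc j)" by (simp add: Bherm)
      thus "mat_adjoint C $$ (i, j) = C $$ (i, j)" using ij B by (simp add: C_def)
    qed (use C in auto)
    let ?e = "mat 1 1 (\<lambda>_. e)"
    have Bblock: "B = four_block_mat ?e (0\<^sub>m 1 n) (0\<^sub>m n 1) C"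
    proof (rule eq_matI)
      fix i j assume "i < dim_row (four_block_mat ?e (0\<^sub>m 1 n) (0\<^sub>m n 1) C)"
        "j < dim_col (four_block_mat ?e (0\<^sub>m 1 n) (0\<^sub>m n 1) C)"
      hence ij: "i < Suc n" "j < Suc n" using C by auto
      thus "B $$ (i, j) = four_block_mat ?e (0\<^sub>m 1 n) (0\<^sub>m n 1) C $$ (i, j)"
        using Bi0[of i] B0j[of j, unfolded ce] C by (cases i; cases j) (auto simp: C_def)
    qed (use B C in auto)
    from Suc.IH[OF C Cherm] obtain V d where V: "V \<in> carrier_mat n n"
      "mat_adjoint V * V = 1\<^sub>m n" "mat_adjoint V * C * V = real_diag n d" by blast
    define W where "W = four_block_mat (1\<^sub>m 1) (0\<^sub>m 1 n) (0\<^sub>m n 1) V"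
    have W: "W \<in> carrier_mat (Suc n) (Suc n)"
      using four_block_carrier_mat[OF one_carrier_mat[of 1] V(1)] by (simp add: W_def)
    have Wadj: "mat_adjoint W = four_block_mat (1\<^sub>m 1) (0\<^sub>m 1 n) (0\<^sub>m n 1) (mat_adjoint V)"
      unfolding W_def mat_adjoint_four_block[OF one_carrier_mat[of 1] zero_carrier_mat zero_carrier_mat V(1)]
      by simp
    have WW: "mat_adjoint W * W = 1\<^sub>m (Suc n)"
    proof -
      have "mat_adjoint W * W = four_block_mat (1\<^sub>m 1) (0\<^sub>m 1 n) (0\<^sub>m n 1) (1\<^sub>m n)"
        unfolding Wadj unfolding W_def using V
        by (subst mult_four_block_mat[of _ 1 1 _ n _ n _ _ 1 _ n]) simp_all
      also have "\<dots> = 1\<^sub>m (Suc n)" by (intro eq_matI) auto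
      finally show ?thesis .
    qed
    have WBW: "mat_adjoint W * B * W = real_diag (Suc n) (case_nat (Re e) d)"
    proof -
      have "mat_adjoint W * B = four_block_mat ?e (0\<^sub>m 1 n) (0\<^sub>m n 1) (mat_adjoint V * C)"
        unfolding Wadj Bblock using V C
        by (subst mult_four_block_mat[of _ 1 1 _ n _ n _ _ 1 _ n]) simp_all
      hence "mat_adjoint W * B * W = four_block_mat ?e (0\<^sub>m 1 n) (0\<^sub>m n 1) (mat_adjoint V * C * V)"
        unfolding W_def using V C
        by (simp only:) (subst mult_four_block_mat[of _ 1 1 _ n _ n _ _ 1 _ n], simp_all)
      also have "\<dots> = real_diag (Suc n) (case_nat (Re e) d)"
        unfolding V(3) using e by (intro eq_matI) (auto simp: real_diag_def split: nat.splits)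
      finally show ?thesis .
    qed
    have "mat_adjoint (U * W) * (U * W) = 1\<^sub>m (Suc n)"
    proof -
      have "mat_adjoint (U * W) * (U * W) = mat_adjoint W * (mat_adjoint U * U) * W"
        using U(1) W by (simp add: mat_adjoint_mult[of _ "Suc n" "Suc n" _ "Suc n"] square_mat_assoc[of _ "Suc n"])
      thus ?thesis using U(2) W WW by simp
    qed
    moreover have "mat_adjoint (U * W) * A * (U * W) = real_diag (Suc n) (case_nat (Re e) d)"
      unfolding WBW[symmetric] B_def using U(1) W A
      by (simp add: mat_adjoint_mult[of _ "Suc n" "Suc n" _ "Suc n"] square_mat_assoc[of _ "Suc n"])
    ultimately show ?case using U(1) W by (intro exI[of _ "U * W"]) auto
  qed
  then obtain V d where V: "V \<in> carrier_mat n n" "mat_adjoint V * V = 1\<^sub>m n"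
    "mat_adjoint V * A * V = real_diag n d" by blast
  have VV: "V * mat_adjoint V = 1\<^sub>m n"
    using mat_mult_left_right_inverse[of "mat_adjoint V" n V] V by simp
  have "V * real_diag n d * mat_adjoint V = (V * mat_adjoint V) * A * (V * mat_adjoint V)"
    unfolding V(3)[symmetric] using V(1) assms(1)
    by (simp add: square_mat_assoc[of _ n])
  also have "\<dots> = A" using assms(1) by (simp add: VV)
  finally show ?thesis using that V by metis
qed

section \<open>Square roots of positive semidefinite matrices\<close>

lemma mat_trace_gram:
  assumes "Y \<in> carrier_mat n n"
  shows "mat_trace (mat_adjoint Y * Y) = complex_of_real (\<Sum>i<n. \<Sum>l<n. (cmod (Y $$ (l, i)))\<^sup>2)"
  using assms by (subst mat_trace_mult[of _ n n])
    (auto simp: mult.commute simp flip: complex_norm_square of_real_power intro!: sum.cong)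

lemma mat_trace_gram_nonneg: "Y \<in> carrier_mat n n \<Longrightarrow> 0 \<le> Re (mat_trace (mat_adjoint Y * Y))"
  by (simp add: mat_trace_gram sum_nonneg)

lemma mat_trace_gram_eq_0:
  assumes "Y \<in> carrier_mat n n" "Re (mat_trace (mat_adjoint Y * Y)) = 0"
  shows "Y = 0\<^sub>m n n"
proof (rule eq_matI)
  have "(\<Sum>i<n. \<Sum>l<n. (cmod (Y $$ (l, i)))\<^sup>2) = 0"
    using assms by (simp add: mat_trace_gram)
  hence *: "\<forall>i<n. \<forall>l<n. Y $$ (l, i) = 0"
    by (subst (asm) sum_nonneg_eq_0_iff) (auto simp: sum_nonneg sum_nonneg_eq_0_iff)
  fix i j assume "i < dim_row (0\<^sub>m n n)" "j < dim_col (0\<^sub>m n n)"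
  thus "Y $$ (i, j) = 0\<^sub>m n n $$ (i, j)" using * by simp
qed (use assms in auto)

lemma gram_mult_vec:
  assumes "X \<in> carrier_mat n n" "v \<in> carrier_vec n"
  shows "Re ((mat_adjoint X * X *\<^sub>v v) \<bullet>c v) = (vnorm (X *\<^sub>v v))\<^sup>2"
proof -
  have "(mat_adjoint X * X *\<^sub>v v) \<bullet>c v = (mat_adjoint X *\<^sub>v (X *\<^sub>v v)) \<bullet>c v"
    using assms by (subst assoc_mult_mat_vec[of _ n n _ n]) auto
  also have "\<dots> = (X *\<^sub>v v) \<bullet>c (X *\<^sub>v v)"
    using cscalar_prod_mult_mat_vec[of "mat_adjoint X" n n "X *\<^sub>v v" v] assms by simp
  finally show ?thesis by (simp add: vnorm_sq)
qed

lemma mat_psd_gram: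
  assumes "X \<in> carrier_mat n n"
  shows "mat_psd (mat_adjoint X * X)"
  unfolding mat_psd_def mat_hermitian_def
  using assms by (auto simp: gram_mult_vec mat_adjoint_mult[of _ n n _ n])

lemma mat_psd_spectral_decomposition:
  assumes "A \<in> carrier_mat n n" "mat_psd A"
  obtains V d where "V \<in> carrier_mat n n" "mat_adjoint V * V = 1\<^sub>m n" "\<And>i. i < n \<Longrightarrow> 0 \<le> d i"
    "A = V * real_diag n d * mat_adjoint V"
proof -
  obtain V d where V: "V \<in> carrier_mat n n" "mat_adjoint V * V = 1\<^sub>m n"
    and A: "A = V * real_diag n d * mat_adjoint V"
    using hermitian_spectral_decomposition assms unfolding mat_psd_def by metis
  have "0 \<le> d i" if i: "i < n" for i
  proof -
    let ?u = "unit_vec n i :: complex vec" and ?v = "V *\<^sub>v unit_vec n i"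
    have v: "?v \<in> carrier_vec n" using V by simp
    have Vv: "mat_adjoint V *\<^sub>v ?v = ?u"
      using V by (subst assoc_mult_mat_vec[symmetric, of _ n n _ n]) auto
    have Du: "real_diag n d *\<^sub>v ?u = complex_of_real (d i) \<cdot>\<^sub>v ?u"
      unfolding real_diag_mult_vec[OF unit_vec_carrier] using i by (intro eq_vecI) auto
    have "A *\<^sub>v ?v = V *\<^sub>v (real_diag n d *\<^sub>v ?u)"
      unfolding A using V v by (simp add: assoc_mult_mat_vec[of _ n n _ n] Vv)
    hence "(A *\<^sub>v ?v) \<bullet>c ?v = (complex_of_real (d i) \<cdot>\<^sub>v ?u) \<bullet>c ?u"
      using cscalar_prod_mult_mat_vec[of V n n "complex_of_real (d i) \<cdot>\<^sub>v ?u" ?v] V v Vv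
      by (simp add: Du)
    also have "\<dots> = complex_of_real (d i) * (?u \<bullet>c ?u)" by simp
    also have "\<dots> = complex_of_real (d i)" using i by (simp add: cscalar_prod_self vnorm_unit_vec)
    finally show "0 \<le> d i" using assms v unfolding mat_psd_def by (metis Re_complex_of_real carrier_matD(1))
  qed
  thus ?thesis using that V A by blast
qed

lemma conj_real_diag_mult:
  assumes "V \<in> carrier_mat n n" "mat_adjoint V * V = 1\<^sub>m n"
  shows "(V * real_diag n d * mat_adjoint V) * (V * real_diag n e * mat_adjoint V)
    = V * real_diag n (\<lambda>i. d i * e i) * mat_adjoint V"
proof -
  have "(V * real_diag n d * mat_adjoint V) * (V * real_diag n e * mat_adjoint V)
      = V * real_diag n d * (mat_adjoint V * V) * (real_diag n e * mat_adjoint V)"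
    using assms(1) by (simp add: square_mat_assoc[of _ n])
  also have "\<dots> = V * (real_diag n d * real_diag n e) * mat_adjoint V"
    unfolding assms(2) using assms(1) by (simp add: square_mat_assoc[of _ n])
  finally show ?thesis by (simp add: real_diag_mult)
qed

lemma mat_trace_conj_real_diag:
  assumes "V \<in> carrier_mat n n" "mat_adjoint V * V = 1\<^sub>m n"
  shows "mat_trace (V * real_diag n d * mat_adjoint V) = complex_of_real (\<Sum>i<n. d i)"
proof -
  have "mat_trace (V * real_diag n d * mat_adjoint V) = mat_trace (mat_adjoint V * V * real_diag n d)"
    using assms(1) by (subst mat_trace_commute[of _ n n]) (auto simp: square_mat_assoc[of _ n])
  thus ?thesis using assms(2) by (simp add: mat_trace_eq[of _ n]) (simp add: real_diag_def)
qed

text \<open>Such a matrix is the Gram matrix of its own square root.\<close>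
lemma mat_psd_conj_real_diag:
  assumes "V \<in> carrier_mat n n" "mat_adjoint V * V = 1\<^sub>m n" "\<And>i. i < n \<Longrightarrow> 0 \<le> d i"
  shows "mat_psd (V * real_diag n d * mat_adjoint V)"
proof -
  let ?Y = "V * real_diag n (\<lambda>i. sqrt (d i)) * mat_adjoint V"
  have "mat_adjoint ?Y = ?Y"
    using assms(1) by (simp add: mat_adjoint_mult[of _ n n _ n] square_mat_assoc[of _ n])
  moreover have "?Y * ?Y = V * real_diag n d * mat_adjoint V"
  proof -
    have "real_diag n (\<lambda>i. sqrt (d i) * sqrt (d i)) = real_diag n d"
      using assms(3) by (intro eq_matI) (auto simp: real_diag_def simp flip: of_real_mult)
    thus ?thesis unfolding conj_real_diag_mult[OF assms(1,2)] by simp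
  qed
  ultimately show ?thesis using mat_psd_gram[of ?Y n] assms(1) by simp
qed

lemma mat_psd_sqrt_exists:
  assumes "A \<in> carrier_mat n n" "mat_psd A"
  obtains B where "B \<in> carrier_mat n n" "mat_psd B" "B * B = A"
proof -
  obtain V d where V: "V \<in> carrier_mat n n" "mat_adjoint V * V = 1\<^sub>m n" "\<And>i. i < n \<Longrightarrow> 0 \<le> d i"
    and A: "A = V * real_diag n d * mat_adjoint V"
    using mat_psd_spectral_decomposition[OF assms] by metis
  let ?B = "V * real_diag n (\<lambda>i. sqrt (d i)) * mat_adjoint V"
  have "real_diag n (\<lambda>i. sqrt (d i) * sqrt (d i)) = real_diag n d"
    using V(3) by (intro eq_matI) (auto simp: real_diag_def simp flip: of_real_mult)
  hence "?B * ?B = A" unfolding conj_real_diag_mult[OF V(1,2)] A by simp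
  moreover have "mat_psd ?B" using V by (intro mat_psd_conj_real_diag) auto
  ultimately show ?thesis using V(1) by (intro that[of ?B]) simp_all
qed

text \<open>With \<open>B = S\<^sup>2\<close> for a Hermitian \<open>S\<close>, the matrix \<open>D B D\<close> is the Gram matrix of \<open>S D\<close>, so its trace is the
  squared Frobenius norm of \<open>S D\<close>.\<close>
lemma mat_psd_sandwich_eq_0:
  assumes B: "B \<in> carrier_mat n n" "mat_psd B" and D: "D \<in> carrier_mat n n" "mat_adjoint D = D"
  shows "0 \<le> Re (mat_trace (D * (B * D)))"
    and "Re (mat_trace (D * (B * D))) = 0 \<Longrightarrow> B * D = 0\<^sub>m n n"
proof -
  obtain S where S: "S \<in> carrier_mat n n" "mat_psd S" "S * S = B"
    using mat_psd_sqrt_exists[OF B] .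
  have Sadj: "mat_adjoint S = S" using S(2) by (simp add: mat_psd_def mat_hermitian_def)
  have eq: "D * (B * D) = mat_adjoint (S * D) * (S * D)"
    unfolding S(3)[symmetric] using S(1) D
    by (simp add: mat_adjoint_mult[of _ n n _ n] square_mat_assoc[of _ n] Sadj)
  show "0 \<le> Re (mat_trace (D * (B * D)))"
    unfolding eq using S(1) D(1) by (intro mat_trace_gram_nonneg[of _ n]) simp
  assume "Re (mat_trace (D * (B * D))) = 0"
  hence "S * D = 0\<^sub>m n n" unfolding eq using S(1) D(1) by (intro mat_trace_gram_eq_0) simp_all
  moreover have "B * D = S * (S * D)"
    unfolding S(3)[symmetric] using S(1) D(1) by (simp add: square_mat_assoc[of _ n])
  ultimately show "B * D = 0\<^sub>m n n" using S(1) by simp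
qed

text \<open>For \<open>D = B - C\<close> one has \<open>B D + D C = B\<^sup>2 - C\<^sup>2 = 0\<close>.  Multiplying by \<open>D\<close> and taking traces,
  \<open>tr (D B D) + tr (D C D) = 0\<close> with both terms nonnegative, so \<open>B D = C D = 0\<close>, hence \<open>D\<^sup>2 = 0\<close>, and a
  Hermitian matrix with square zero vanishes.\<close>
lemma mat_psd_sqrt_unique:
  assumes B: "B \<in> carrier_mat n n" "mat_psd B" and C: "C \<in> carrier_mat n n" "mat_psd C"
    and eq: "B * B = C * C"
  shows "B = C"
proof -
  define D where "D = B - C"
  have D: "D \<in> carrier_mat n n" using B C by (simp add: D_def)
  have Dadj: "mat_adjoint D = D"
    using B C by (simp add: D_def mat_adjoint_minus[of _ n n] mat_psd_def mat_hermitian_def)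
  have "B * D + D * C = 0\<^sub>m n n"
  proof -
    have "B * D = B * B - B * C" "D * C = B * C - C * C"
      unfolding D_def using B(1) C(1) by (auto simp: mult_minus_distrib_mat minus_mult_distrib_mat)
    thus ?thesis unfolding eq using B(1) C(1) by (intro eq_matI) auto
  qed
  hence "D * (B * D) + D * (D * C) = 0\<^sub>m n n"
    using B(1) C(1) D by (subst mult_add_distrib_mat[symmetric, of _ n n _ n]) auto
  moreover have "mat_trace (D * (D * C)) = mat_trace (D * (C * D))"
    using C(1) D by (subst mat_trace_commute[of _ n n]) (auto simp: square_mat_assoc[of _ n])
  ultimately have "mat_trace (D * (B * D)) + mat_trace (D * (C * D)) = 0"
    using B(1) C(1) D mat_trace_add[of "D * (B * D)" n "D * (D * C)"]
    by (simp add: mat_trace_def)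
  hence "Re (mat_trace (D * (B * D))) + Re (mat_trace (D * (C * D))) = 0"
    by (metis plus_complex.sel(1) zero_complex.sel(1))
  hence "B * D = 0\<^sub>m n n" "C * D = 0\<^sub>m n n"
    using mat_psd_sandwich_eq_0[OF B D Dadj] mat_psd_sandwich_eq_0[OF C D Dadj] by linarith+
  hence "D * D = 0\<^sub>m n n"
    unfolding D_def using B(1) C(1) D by (subst minus_mult_distrib_mat[of _ n n _ _ n]) (auto simp flip: D_def)
  hence "D = 0\<^sub>m n n"
    using D mat_trace_gram_eq_0[OF D] by (simp add: Dadj mat_trace_def)
  show ?thesis
  proof (rule eq_matI)
    fix i j assume "i < dim_row C" "j < dim_col C"
    hence ij: "i < n" "j < n" using C by auto
    have "D $$ (i, j) = 0" using \<open>D = 0\<^sub>m n n\<close> ij by simp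
    thus "B $$ (i, j) = C $$ (i, j)" using ij B C by (simp add: D_def)
  qed (use B C in auto)
qed

text \<open>The definite description in the definition of the square root is resolved by existence and uniqueness;
  a Hermitian matrix is square, which supplies the dimension that the description leaves open.\<close>
lemma mat_sqrt:
  assumes "A \<in> carrier_mat n n" "mat_psd A"
  shows "mat_sqrt A \<in> carrier_mat n n" "mat_psd (mat_sqrt A)" "mat_sqrt A * mat_sqrt A = A"
proof -
  have sq: "B \<in> carrier_mat n n" if "mat_psd B" "B * B = A" for B
  proof -
    have "dim_row B = dim_col B"
      using that(1) unfolding mat_psd_def mat_hermitian_def by (metis dim_mat_adjoint(1))
    moreover have "dim_row B = n" using arg_cong[OF that(2), of dim_row] assms(1) by simp
    ultimately show ?thesis by (metis carrier_matI)
  qed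
  obtain B where B: "B \<in> carrier_mat n n" "mat_psd B" "B * B = A"
    using mat_psd_sqrt_exists[OF assms] .
  have "mat_psd (mat_sqrt A) \<and> mat_sqrt A * mat_sqrt A = A"
    unfolding mat_sqrt_def
  proof (rule theI)
    show "mat_psd B \<and> B * B = A" using B by simp
    show "C = B" if "mat_psd C \<and> C * C = A" for C
      using that B sq[of C] mat_psd_sqrt_unique[of C n B] by metis
  qed
  thus "mat_psd (mat_sqrt A)" "mat_sqrt A * mat_sqrt A = A" "mat_sqrt A \<in> carrier_mat n n"
    using sq by auto
qed

section \<open>The trace norm and its dual description\<close>

text \<open>The trace norm is the sum of the eigenvalues \<open>d i\<close> of \<open>P = \<bar>X\<bar> = sqrt (X\<^sup>* X)\<close>, and since
  \<open>P\<^sup>2 = X\<^sup>* X\<close> the matrices \<open>X\<close> and \<open>P\<close> stretch every vector by the same factor.  All comparisons of the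
  trace norm with operator norms reduce through this to the diagonal matrix of the \<open>d i\<close>.\<close>
lemma absolute_value_spectral:
  assumes X: "X \<in> carrier_mat n n"
  obtains P V d where "P = V * real_diag n d * mat_adjoint V" "V \<in> carrier_mat n n"
    "mat_adjoint V * V = 1\<^sub>m n" "\<And>i. i < n \<Longrightarrow> 0 \<le> d i"
    "P * P = mat_adjoint X * X" "trace_norm X = (\<Sum>i<n. d i)"
    "\<And>v. v \<in> carrier_vec n \<Longrightarrow> vnorm (X *\<^sub>v v) = vnorm (P *\<^sub>v v)"
proof -
  define P where "P = mat_sqrt (mat_adjoint X * X)"
  have "mat_adjoint X * X \<in> carrier_mat n n" using X by simp
  note P = mat_sqrt[OF this mat_psd_gram[OF X], folded P_def]
  obtain V d where V: "V \<in> carrier_mat n n" "mat_adjoint V * V = 1\<^sub>m n" "\<And>i. i < n \<Longrightarrow> 0 \<le> d i"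
    and Peq: "P = V * real_diag n d * mat_adjoint V"
    using mat_psd_spectral_decomposition[OF P(1,2)] by metis
  have "trace_norm X = (\<Sum>i<n. d i)"
    unfolding trace_norm_def P_def[symmetric] Peq mat_trace_conj_real_diag[OF V(1,2)] by simp
  moreover have "vnorm (X *\<^sub>v v) = vnorm (P *\<^sub>v v)" if v: "v \<in> carrier_vec n" for v
  proof -
    have "mat_adjoint P * P = mat_adjoint X * X"
      using P by (simp add: mat_psd_def mat_hermitian_def)
    hence "(vnorm (X *\<^sub>v v))\<^sup>2 = (vnorm (P *\<^sub>v v))\<^sup>2"
      using gram_mult_vec[OF X v] gram_mult_vec[OF P(1) v] by simp
    thus ?thesis by simp
  qed
  ultimately show ?thesis using that[OF Peq V P(3)] by blast
qed

lemma op_bound_unitary: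
  assumes "V \<in> carrier_mat n n" "mat_adjoint V * V = 1\<^sub>m n"
  shows "op_bound n V 1"
  using assms by (simp add: op_bound_def vnorm_unitary)

lemma op_bound_conj_real_diag:
  assumes "V \<in> carrier_mat n n" "mat_adjoint V * V = 1\<^sub>m n"
    "\<And>i. i < n \<Longrightarrow> \<bar>d i\<bar> \<le> c" "0 \<le> c"
  shows "op_bound n (V * real_diag n d * mat_adjoint V) c"
  using op_bound_mult[OF op_bound_mult[OF op_bound_unitary[OF assms(1,2)] op_bound_real_diag[OF assms(3,4)]]
      op_bound_adjoint[OF op_bound_unitary[OF assms(1,2)]]] by simp

text \<open>The largest singular value is at most the sum of all of them.\<close>
lemma op_bound_trace_norm:
  assumes X: "X \<in> carrier_mat n n"
  shows "op_bound n X (trace_norm X)"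
proof -
  obtain P V d where P: "P = V * real_diag n d * mat_adjoint V" "V \<in> carrier_mat n n"
    "mat_adjoint V * V = 1\<^sub>m n" "\<And>i. i < n \<Longrightarrow> 0 \<le> d i"
    "trace_norm X = (\<Sum>i<n. d i)" "\<And>v. v \<in> carrier_vec n \<Longrightarrow> vnorm (X *\<^sub>v v) = vnorm (P *\<^sub>v v)"
    using absolute_value_spectral[OF X] by metis
  have "op_bound n P (trace_norm X)"
    unfolding P(1,5)
  proof (rule op_bound_conj_real_diag[OF P(2,3)])
    show "\<bar>d i\<bar> \<le> sum d {..<n}" if "i < n" for i
      using that P(4) member_le_sum[of i "{..<n}" d] by simp
    show "0 \<le> sum d {..<n}" using P(4) by (intro sum_nonneg) simp
  qed
  thus ?thesis using X by (simp add: op_bound_def P(6))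
qed

text \<open>By duality between the trace norm and the operator norm this is the trace norm again.  In this form
  subadditivity and the two-sided ideal property are immediate, and an estimate of the norm reduces to an
  estimate of the scalars \<open>tr (W X)\<close>, which are linear in \<open>X\<close>.\<close>
definition dual_norm :: "nat \<Rightarrow> complex mat \<Rightarrow> real" where
  "dual_norm n X = (SUP W\<in>{W. op_bound n W 1}. cmod (mat_trace (W * X)))"

lemma dual_norm_le:
  assumes "\<And>W. op_bound n W 1 \<Longrightarrow> cmod (mat_trace (W * X)) \<le> b"
  shows "dual_norm n X \<le> b"
  unfolding dual_norm_def using op_bound_one[of n] assms by (intro cSUP_least) auto

lemma norm_trace_le_sum:
  assumes X: "X \<in> carrier_mat n n" and W: "op_bound n W 1"
  shows "cmod (mat_trace (W * X)) \<le> (\<Sum>i<n. \<Sum>l<n. cmod (X $$ (l, i)))"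
  unfolding mat_trace_mult[OF op_bound_carrier[OF W] X]
proof (intro sum_norm_le)
  fix i l assume "i \<in> {..<n}" "l \<in> {..<n}"
  hence "cmod (W $$ (i, l)) \<le> 1" using op_bound_index_le[OF W] by simp
  thus "cmod (W $$ (i, l) * X $$ (l, i)) \<le> cmod (X $$ (l, i))"
    by (simp add: norm_mult mult_left_le_one_le)
qed

lemma dual_norm_le_sum:
  "X \<in> carrier_mat n n \<Longrightarrow> dual_norm n X \<le> (\<Sum>i<n. \<Sum>l<n. cmod (X $$ (l, i)))"
  by (intro dual_norm_le norm_trace_le_sum)

lemma norm_trace_contraction_le:
  assumes X: "X \<in> carrier_mat n n" and W: "op_bound n W 1"
  shows "cmod (mat_trace (W * X)) \<le> dual_norm n X"
  unfolding dual_norm_def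
  by (rule cSUP_upper) (use norm_trace_le_sum[OF X] W in \<open>auto intro!: bdd_aboveI2\<close>)

lemma dual_norm_nonneg: "X \<in> carrier_mat n n \<Longrightarrow> 0 \<le> dual_norm n X"
  using norm_trace_contraction_le[OF _ op_bound_one] norm_ge_zero order_trans by blast

text \<open>Rescaling to a contraction; for \<open>c = 0\<close> this is impossible, but then \<open>W\<close> is zero.\<close>
lemma norm_trace_le_dual_norm:
  assumes X: "X \<in> carrier_mat n n" and W: "op_bound n W c"
  shows "cmod (mat_trace (W * X)) \<le> c * dual_norm n X"
proof (cases "c = 0")
  case True
  have "W $$ (i, j) = 0" if "i < n" "j < n" for i j
    using op_bound_index_le[OF W that] True by simp
  thus ?thesis using True mat_trace_mult[OF op_bound_carrier[OF W] X] by simp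
next
  case False
  hence c: "0 < c" using op_bound_nonneg[OF W] by simp
  let ?W = "complex_of_real (1 / c) \<cdot>\<^sub>m W"
  have "op_bound n ?W 1"
    using op_bound_smult[OF W, of "complex_of_real (1 / c)"] c by (simp add: norm_divide)
  from norm_trace_contraction_le[OF X this]
  have "cmod (complex_of_real (1 / c) * mat_trace (W * X)) \<le> dual_norm n X"
    using X op_bound_carrier[OF W] by (simp add: mat_trace_smult[of _ n] mult_smult_assoc_mat[of _ n n _ n])
  thus ?thesis using c by (simp add: norm_mult norm_divide field_simps)
qed

lemma dual_norm_add:
  assumes "X \<in> carrier_mat n n" "Y \<in> carrier_mat n n"
  shows "dual_norm n (X + Y) \<le> dual_norm n X + dual_norm n Y"
proof (rule dual_norm_le)
  fix W assume W: "op_bound n W 1"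
  have "mat_trace (W * (X + Y)) = mat_trace (W * X) + mat_trace (W * Y)"
    using assms op_bound_carrier[OF W] by (simp add: mult_add_distrib_mat[of _ n n _ n] mat_trace_add[of _ n])
  thus "cmod (mat_trace (W * (X + Y))) \<le> dual_norm n X + dual_norm n Y"
    using norm_triangle_ineq[of "mat_trace (W * X)" "mat_trace (W * Y)"]
      norm_trace_contraction_le[OF assms(1) W] norm_trace_contraction_le[OF assms(2) W] by simp
qed

lemma dual_norm_smult:
  assumes X: "X \<in> carrier_mat n n"
  shows "dual_norm n (c \<cdot>\<^sub>m X) \<le> cmod c * dual_norm n X"
proof (rule dual_norm_le)
  fix W assume W: "op_bound n W 1"
  have "mat_trace (W * (c \<cdot>\<^sub>m X)) = c * mat_trace (W * X)"
    using X op_bound_carrier[OF W] by (simp add: mult_smult_distrib[of _ n n _ n] mat_trace_smult[of _ n])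
  thus "cmod (mat_trace (W * (c \<cdot>\<^sub>m X))) \<le> cmod c * dual_norm n X"
    using norm_trace_contraction_le[OF X W] by (simp add: norm_mult mult_left_mono)
qed

lemma dual_norm_diff:
  assumes "X \<in> carrier_mat n n" "Y \<in> carrier_mat n n"
  shows "dual_norm n (X - Y) \<le> dual_norm n X + dual_norm n Y"
proof -
  have "X - Y = X + (-1) \<cdot>\<^sub>m Y" using assms by (intro eq_matI) auto
  thus ?thesis
    using dual_norm_add[of X n "(-1) \<cdot>\<^sub>m Y"] dual_norm_smult[of Y n "-1"] assms by simp
qed

text \<open>By cyclicity of the trace, \<open>tr (W A X B) = tr ((B W A) X)\<close>, so the factors move into the test matrix.\<close>
lemma dual_norm_mult_both:
  assumes X: "X \<in> carrier_mat n n" and A: "op_bound n A a" and B: "op_bound n B b"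
  shows "dual_norm n (A * X * B) \<le> a * b * dual_norm n X"
proof (rule dual_norm_le)
  fix W assume W: "op_bound n W 1"
  note c = op_bound_carrier[OF A] op_bound_carrier[OF B] op_bound_carrier[OF W] X
  have "mat_trace (W * (A * X * B)) = mat_trace (B * W * A * X)"
    using mat_trace_commute[of "W * A * X" n n B] c by (simp add: square_mat_assoc[of _ n])
  also have "cmod \<dots> \<le> b * 1 * a * dual_norm n X"
    by (intro norm_trace_le_dual_norm[OF X] op_bound_mult A B W)
  finally show "cmod (mat_trace (W * (A * X * B))) \<le> a * b * dual_norm n X" by (simp add: mult_ac)
qed

lemma dual_norm_zero: "dual_norm n (0\<^sub>m n n) \<le> 0"
  using dual_norm_le_sum[of "0\<^sub>m n n" n] by simp

lemma mat_sum_carrier [simp]: "mat_sum n F S \<in> carrier_mat n n"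
  and dim_mat_sum [simp]: "dim_row (mat_sum n F S) = n" "dim_col (mat_sum n F S) = n"
  by (simp_all add: mat_sum_def)

lemma dual_norm_mat_sum:
  assumes "finite S" "\<And>k. k \<in> S \<Longrightarrow> F k \<in> carrier_mat n n"
  shows "dual_norm n (mat_sum n F S) \<le> (\<Sum>k\<in>S. dual_norm n (F k))"
  using assms
proof (induction S rule: finite_induct)
  case empty
  have "mat_sum n F {} = 0\<^sub>m n n" by (intro eq_matI) (auto simp: mat_sum_def)
  thus ?case using dual_norm_zero by simp
next
  case (insert k S)
  have "mat_sum n F (insert k S) = F k + mat_sum n F S"
    using insert by (intro eq_matI) (auto simp: mat_sum_def)
  thus ?case using insert dual_norm_add[of "F k" n "mat_sum n F S"] by fastforce
qed

text \<open>The test matrix is the adjoint of the unitary factor of a polar decomposition \<open>X = U P\<close>.  The factor is obtained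
  as \<open>X G\<close>, where \<open>G\<close> is the pseudo-inverse of \<open>P\<close>, so it is only a partial isometry when \<open>X\<close> is singular;
  being a contraction is enough.\<close>
lemma trace_norm_le_dual_norm:
  assumes X: "X \<in> carrier_mat n n"
  shows "trace_norm X \<le> dual_norm n X"
proof -
  obtain P V d where P: "P = V * real_diag n d * mat_adjoint V" "V \<in> carrier_mat n n"
    "mat_adjoint V * V = 1\<^sub>m n" "\<And>i. i < n \<Longrightarrow> 0 \<le> d i"  "P * P = mat_adjoint X * X"
    "trace_norm X = (\<Sum>i<n. d i)" "\<And>v. v \<in> carrier_vec n \<Longrightarrow> vnorm (X *\<^sub>v v) = vnorm (P *\<^sub>v v)"
    using absolute_value_spectral[OF X] by metis
  have Pc: "P \<in> carrier_mat n n" using P(1,2) by simp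
  define g where "g i = (if d i = 0 then 0 else 1 / d i)" for i
  define G where "G = V * real_diag n g * mat_adjoint V"
  have G: "G \<in> carrier_mat n n" using P(2) by (simp add: G_def)
  have "op_bound n (P * G) 1"
    unfolding P(1) G_def conj_real_diag_mult[OF P(2,3)]
    by (rule op_bound_conj_real_diag[OF P(2,3)]) (auto simp: g_def)
  moreover have "vnorm (X * G *\<^sub>v v) = vnorm (P * G *\<^sub>v v)" if "v \<in> carrier_vec n" for v
    using that X G Pc by (simp add: assoc_mult_mat_vec[of _ n n _ n] P(7))
  ultimately have XG: "op_bound n (X * G) 1" using X G by (simp add: op_bound_def)
  have "mat_adjoint G = G" using P(2)
    by (simp add: G_def mat_adjoint_mult[of _ n n _ n] square_mat_assoc[of _ n])
  hence "mat_adjoint (X * G) * X = G * (P * P)"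
    using X G by (simp add: mat_adjoint_mult[of _ n n _ n] square_mat_assoc[of _ n] P(5))
  also have "\<dots> = V * real_diag n (\<lambda>i. g i * (d i * d i)) * mat_adjoint V"
    unfolding G_def P(1) conj_real_diag_mult[OF P(2,3)] ..
  also have "(\<lambda>i. g i * (d i * d i)) = d" by (auto simp: g_def)
  finally have "mat_trace (mat_adjoint (X * G) * X) = complex_of_real (trace_norm X)"
    using mat_trace_conj_real_diag[OF P(2,3)] P(6) by simp
  thus ?thesis using norm_trace_contraction_le[OF X op_bound_adjoint[OF XG]] by simp
qed

text \<open>In an eigenbasis of \<open>X\<close> the trace of \<open>W X\<close> is the sum of the nonnegative eigenvalues, weighted by diagonal
  entries of a contraction, which have modulus at most one.\<close>
lemma dual_norm_psd_le:
  assumes X: "X \<in> carrier_mat n n" "mat_psd X"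
  shows "dual_norm n X \<le> Re (mat_trace X)"
proof (rule dual_norm_le)
  fix W assume W: "op_bound n W 1"
  note Wc = op_bound_carrier[OF W]
  obtain V d where V: "V \<in> carrier_mat n n" "mat_adjoint V * V = 1\<^sub>m n" "\<And>i. i < n \<Longrightarrow> 0 \<le> d i"
    and Xeq: "X = V * real_diag n d * mat_adjoint V"
    using mat_psd_spectral_decomposition[OF X] by metis
  let ?U = "mat_adjoint V * W * V"
  have U: "op_bound n ?U 1"
    using op_bound_mult[OF op_bound_mult[OF op_bound_adjoint[OF op_bound_unitary[OF V(1,2)]] W] op_bound_unitary[OF V(1,2)]]
    by simp
  have "mat_trace (W * X) = mat_trace (?U * real_diag n d)"
    unfolding Xeq using V(1) Wc mat_trace_commute[of "W * V * real_diag n d" n n "mat_adjoint V"]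
    by (simp add: square_mat_assoc[of _ n])
  also have "\<dots> = (\<Sum>i<n. ?U $$ (i, i) * complex_of_real (d i))"
    unfolding mat_trace_mult[OF op_bound_carrier[OF U] real_diag_carrier]
    by (intro sum.cong) (auto simp: real_diag_def if_distrib[of "\<lambda>x. _ * x"] cong: if_cong)
  also have "cmod \<dots> \<le> (\<Sum>i<n. d i)"
  proof (rule sum_norm_le)
    fix i assume "i \<in> {..<n}"
    thus "cmod (?U $$ (i, i) * complex_of_real (d i)) \<le> d i"
      using V(3)[of i] op_bound_index_le[OF U, of i i] by (simp add: norm_mult mult_left_le_one_le del: index_mult_mat)
  qed
  also have "\<dots> = Re (mat_trace X)" unfolding Xeq mat_trace_conj_real_diag[OF V(1,2)] by simp
  finally show "cmod (mat_trace (W * X)) \<le> Re (mat_trace X)" .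
qed

section \<open>Derivatives and a Gronwall inequality\<close>

lemma has_mat_derivativeI:
  assumes "D \<in> carrier_mat n n"
    "\<And>i j. i < n \<Longrightarrow> j < n \<Longrightarrow> ((\<lambda>t. F t $$ (i, j)) has_vector_derivative D $$ (i, j)) net"
  shows "has_mat_derivative F D net"
  using assms by (auto simp: has_mat_derivative_def)

lemma has_mat_derivativeD:
  assumes "has_mat_derivative F D net" "D \<in> carrier_mat n n" "i < n" "j < n"
  shows "((\<lambda>t. F t $$ (i, j)) has_vector_derivative D $$ (i, j)) net"
  using assms by (auto simp: has_mat_derivative_def)

lemma has_mat_derivative_subset:
  "has_mat_derivative F D (at t within S) \<Longrightarrow> T \<subseteq> S \<Longrightarrow> has_mat_derivative F D (at t within T)"
  unfolding has_mat_derivative_def by (blast intro: has_vector_derivative_within_subset)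

lemma has_mat_derivative_shift:
  assumes F: "has_mat_derivative F D (at (a + t) within S)" and "(+) a ` U \<subseteq> S"
  shows "has_mat_derivative (\<lambda>s. F (a + s)) D (at t within U)"
  unfolding has_mat_derivative_def
proof (intro allI impI)
  fix i j assume ij: "i < dim_row D" "j < dim_col D"
  have "((+) a has_vector_derivative 1) (at t within U)"
    by (auto intro!: derivative_eq_intros)
  moreover have "((\<lambda>s. F s $$ (i, j)) has_vector_derivative D $$ (i, j)) (at (a + t) within (+) a ` U)"
    using has_mat_derivative_subset[OF assms] ij unfolding has_mat_derivative_def by blast
  ultimately show "((\<lambda>s. F (a + s) $$ (i, j)) has_vector_derivative D $$ (i, j)) (at t within U)"
    using vector_diff_chain_within by (fastforce simp: o_def)
qed

lemma has_mat_derivative_const: "has_mat_derivative (\<lambda>_. A) (0\<^sub>m n n) net"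
  by (rule has_mat_derivativeI[of _ n]) auto

lemma has_mat_derivative_mult:
  assumes F: "has_mat_derivative F D (at t within S)" and G: "has_mat_derivative G E (at t within S)"
    and "\<And>s. F s \<in> carrier_mat n n" "\<And>s. G s \<in> carrier_mat n n"
    "D \<in> carrier_mat n n" "E \<in> carrier_mat n n"
  shows "has_mat_derivative (\<lambda>s. F s * G s) (F t * E + D * G t) (at t within S)"
proof (rule has_mat_derivativeI[of _ n])
  fix i j assume ij: "i < n" "j < n"
  have "((\<lambda>s. \<Sum>l<n. F s $$ (i, l) * G s $$ (l, j)) has_vector_derivative
      (\<Sum>l<n. F t $$ (i, l) * E $$ (l, j) + D $$ (i, l) * G t $$ (l, j))) (at t within S)"
    using ij assms(5,6)
    by (intro has_vector_derivative_sum has_vector_derivative_mult has_mat_derivativeD[OF F]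
        has_mat_derivativeD[OF G]) auto
  moreover have "(\<lambda>s. (F s * G s) $$ (i, j)) = (\<lambda>s. \<Sum>l<n. F s $$ (i, l) * G s $$ (l, j))"
    by (rule ext, rule index_mult_mat_sum[OF assms(3,4) ij])
  moreover have "(F t * E + D * G t) $$ (i, j) = (F t * E) $$ (i, j) + (D * G t) $$ (i, j)"
    using ij assms(3-6) by (intro index_add_mat) (auto simp: carrier_matD[OF assms(4)] carrier_matD[OF assms(5)])
  moreover have "\<dots> = (\<Sum>l<n. F t $$ (i, l) * E $$ (l, j) + D $$ (i, l) * G t $$ (l, j))"
    unfolding index_mult_mat_sum[OF assms(3,6) ij] index_mult_mat_sum[OF assms(5,4) ij]
    by (rule sum.distrib[symmetric])
  ultimately show "((\<lambda>s. (F s * G s) $$ (i, j)) has_vector_derivative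
      (F t * E + D * G t) $$ (i, j)) (at t within S)" by simp
qed (use assms in simp)

lemma has_mat_derivative_diff:
  assumes F: "has_mat_derivative F D (at t within S)" and G: "has_mat_derivative G E (at t within S)"
    and c: "\<And>s. s \<in> S \<Longrightarrow> F s \<in> carrier_mat n n" "\<And>s. s \<in> S \<Longrightarrow> G s \<in> carrier_mat n n"
    "D \<in> carrier_mat n n" "E \<in> carrier_mat n n" and t: "t \<in> S"
  shows "has_mat_derivative (\<lambda>s. F s - G s) (D - E) (at t within S)"
proof (rule has_mat_derivativeI[of _ n])
  fix i j assume ij: "i < n" "j < n"
  have entry: "(F s - G s) $$ (i, j) = F s $$ (i, j) - G s $$ (i, j)" if "s \<in> S" for s
    using c(1,2)[OF that] ij by simp
  have "((\<lambda>s. F s $$ (i, j) - G s $$ (i, j)) has_vector_derivative D $$ (i, j) - E $$ (i, j))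
      (at t within S)"
    using ij c by (intro has_vector_derivative_diff has_mat_derivativeD[OF F] has_mat_derivativeD[OF G]) auto
  hence "((\<lambda>s. (F s - G s) $$ (i, j)) has_vector_derivative D $$ (i, j) - E $$ (i, j)) (at t within S)"
    by (rule has_vector_derivative_transform[OF t, rotated]) (use entry in auto)
  thus "((\<lambda>s. (F s - G s) $$ (i, j)) has_vector_derivative (D - E) $$ (i, j)) (at t within S)"
    using c ij by simp
qed (use c in simp)

lemma has_mat_derivative_continuous_entry:
  assumes "\<And>t. t \<in> S \<Longrightarrow> D t \<in> carrier_mat n n"
    "\<And>t. t \<in> S \<Longrightarrow> has_mat_derivative F (D t) (at t within S)" "i < n" "j < n"
  shows "continuous_on S (\<lambda>t. F t $$ (i, j))"
  by (rule continuous_on_vector_derivative[where f' = "\<lambda>t. D t $$ (i, j)"])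
    (use assms in \<open>auto intro: has_mat_derivativeD\<close>)

text \<open>Each contraction \<open>W\<close> turns the curve into the scalar curve \<open>tr (W F)\<close>, for which the estimate is the
  ordinary mean value inequality; the supremum over \<open>W\<close> gives the norm.\<close>
lemma dual_norm_mean_value:
  assumes ab: "a \<le> b"
    and F: "\<And>t. t \<in> {a..b} \<Longrightarrow> F t \<in> carrier_mat n n"
    and D: "\<And>t. t \<in> {a..b} \<Longrightarrow> D t \<in> carrier_mat n n"
    and deriv: "\<And>t. t \<in> {a..b} \<Longrightarrow> has_mat_derivative F (D t) (at t within {a..b})"
    and \<phi>: "\<And>t. (\<phi> has_real_derivative \<phi>' t) (at t)"
    and bound: "\<And>t. a < t \<Longrightarrow> t < b \<Longrightarrow> dual_norm n (D t) \<le> \<phi>' t"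
  shows "dual_norm n (F b - F a) \<le> \<phi> b - \<phi> a"
proof (cases "a = b")
  case True
  have "F b - F a = 0\<^sub>m n n" using F[of a] True ab by (intro eq_matI) auto
  thus ?thesis using True dual_norm_zero by simp
next
  case False
  hence ab: "a < b" using ab by simp
  show ?thesis
  proof (rule dual_norm_le)
    fix W assume W: "op_bound n W 1"
    note Wc = op_bound_carrier[OF W]
    define f where "f t = (\<Sum>i<n. \<Sum>l<n. W $$ (i, l) * F t $$ (l, i))" for t
    have f': "(f has_vector_derivative mat_trace (W * D t)) (at t within {a..b})"
      if t: "t \<in> {a..b}" for t
      unfolding f_def mat_trace_mult[OF Wc D[OF t]]
      by (intro has_vector_derivative_sum has_vector_derivative_mult_right
          has_mat_derivativeD[OF deriv[OF t] D[OF t]]) auto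
    have "norm (f b - f a) \<le> \<phi> b - \<phi> a"
    proof (rule differentiable_bound_general[OF ab])
      show "continuous_on {a..b} f" using f' by (rule continuous_on_vector_derivative)
      show "continuous_on {a..b} \<phi>" using \<phi> by (meson DERIV_continuous_on DERIV_subset subset_UNIV)
      fix t assume t: "a < t" "t < b"
      show "(f has_vector_derivative mat_trace (W * D t)) (at t)"
        using f'[of t] t by (simp add: at_within_Icc_at)
      show "(\<phi> has_vector_derivative \<phi>' t) (at t)"
        using \<phi> by (simp add: has_real_derivative_iff_has_vector_derivative)
      show "norm (mat_trace (W * D t)) \<le> \<phi>' t"
        using norm_trace_contraction_le[OF D W, of t] bound[OF t] t by simp
    qed
    moreover have "f b - f a = mat_trace (W * (F b - F a))"
    proof -
      have "mat_trace (W * (F b - F a))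
          = (\<Sum>i<n. \<Sum>l<n. W $$ (i, l) * (F b - F a) $$ (l, i))"
        using F[of a] F[of b] ab by (intro mat_trace_mult[OF Wc]) simp
      also have "\<dots> = (\<Sum>i<n. \<Sum>l<n. W $$ (i, l) * F b $$ (l, i) - W $$ (i, l) * F a $$ (l, i))"
        using F[of a] F[of b] ab by (intro sum.cong) (auto simp: right_diff_distrib)
      finally show ?thesis by (simp add: f_def sum_subtractf)
    qed
    ultimately show "cmod (mat_trace (W * (F b - F a))) \<le> \<phi> b - \<phi> a" by simp
  qed
qed

text \<open>Makes the supremum in the Gronwall argument below finite.\<close>
lemma dual_norm_bounded_on_interval:
  fixes T :: real
  assumes F: "\<And>t. t \<in> {0..T} \<Longrightarrow> F t \<in> carrier_mat n n"
    and D: "\<And>t. t \<in> {0..T} \<Longrightarrow> D t \<in> carrier_mat n n"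
    and deriv: "\<And>t. t \<in> {0..T} \<Longrightarrow> has_mat_derivative F (D t) (at t within {0..T})"
  obtains B where "\<And>t. t \<in> {0..T} \<Longrightarrow> dual_norm n (F t) \<le> B"
proof -
  let ?g = "\<lambda>t. \<Sum>i<n. \<Sum>l<n. cmod (F t $$ (l, i))"
  have "continuous_on {0..T} ?g"
    by (intro continuous_on_sum continuous_on_norm has_mat_derivative_continuous_entry[OF D deriv]) auto
  hence "compact (?g ` {0..T})" by (intro compact_continuous_image) auto
  hence "bounded (?g ` {0..T})" by (rule compact_imp_bounded)
  then obtain B where "\<forall>t\<in>{0..T}. \<bar>?g t\<bar> \<le> B"
    by (auto simp: bounded_iff)
  hence B: "\<bar>?g t\<bar> \<le> B" if "t \<in> {0..T}" for t
    using that by blast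
  have "dual_norm n (F t) \<le> B" if "t \<in> {0..T}" for t
    using dual_norm_le_sum[OF F[OF that]] B[OF that] by linarith
  thus ?thesis using that by blast
qed

text \<open>Let \<open>b\<close> be the supremum of \<open>exp (- 2 M t) * dual_norm n (F t)\<close>.  The mean value inequality against
  \<open>b / 2 * exp (2 M t)\<close> gives \<open>b \<le> dual_norm n (F 0) + b / 2\<close>.  Weighting with twice the rate \<open>M\<close> is what produces
  the factor one half and lets \<open>b\<close> be absorbed; the price is the factor 2 and the doubled exponent, which
  affect only the value of the error constant.\<close>
lemma dual_norm_gronwall:
  assumes M: "0 < M"
    and F: "\<And>t. t \<in> {0..T} \<Longrightarrow> F t \<in> carrier_mat n n"
    and D: "\<And>t. t \<in> {0..T} \<Longrightarrow> D t \<in> carrier_mat n n"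
    and deriv: "\<And>t. t \<in> {0..T} \<Longrightarrow> has_mat_derivative F (D t) (at t within {0..T})"
    and bound: "\<And>t. t \<in> {0..T} \<Longrightarrow> dual_norm n (D t) \<le> M * dual_norm n (F t)"
    and t: "t \<in> {0..T}"
  shows "dual_norm n (F t) \<le> 2 * exp (2 * M * t) * dual_norm n (F 0)"
proof -
  have T: "0 \<le> T" using t by simp
  obtain B where B: "\<And>t. t \<in> {0..T} \<Longrightarrow> dual_norm n (F t) \<le> B"
    using dual_norm_bounded_on_interval[OF F D deriv] by blast
  let ?h = "\<lambda>t. exp (- (2 * M * t)) * dual_norm n (F t)"
  define b where "b = (SUP t\<in>{0..T}. ?h t)"
  have "?h t \<le> B" if "t \<in> {0..T}" for t
  proof -
    have "?h t \<le> 1 * dual_norm n (F t)"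
      using M that dual_norm_nonneg[OF F[OF that]] by (intro mult_right_mono) auto
    thus ?thesis using B[OF that] by simp
  qed
  hence bdd: "bdd_above (?h ` {0..T})" by (intro bdd_aboveI2)
  have le_b: "?h t \<le> b" if "t \<in> {0..T}" for t
    unfolding b_def using that bdd by (rule cSUP_upper)
  have F_le: "dual_norm n (F t) \<le> b * exp (2 * M * t)" if "t \<in> {0..T}" for t
    using le_b[OF that] by (simp add: exp_minus field_simps)
  have b0: "0 \<le> b" using F_le[of 0] dual_norm_nonneg[OF F[of 0]] T by simp
  have "?h t \<le> dual_norm n (F 0) + b / 2" if t: "t \<in> {0..T}" for t
  proof -
    have "dual_norm n (F t - F 0) \<le> b / 2 * exp (2 * M * t) - b / 2 * exp (2 * M * 0)"
    proof (rule dual_norm_mean_value[where D = D and \<phi>' = "\<lambda>s. M * (b * exp (2 * M * s))"])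
      fix s
      show "((\<lambda>t. b / 2 * exp (2 * M * t)) has_real_derivative M * (b * exp (2 * M * s))) (at s)"
        by (auto intro!: derivative_eq_intros)
      assume "0 < s" "s < t"
      hence s: "s \<in> {0..T}" using t by simp
      show "dual_norm n (D s) \<le> M * (b * exp (2 * M * s))"
        using order_trans[OF bound[OF s] mult_left_mono[OF F_le[OF s], of M]] M by simp
    next
      fix s assume s: "s \<in> {0..t}"
      thus "has_mat_derivative F (D s) (at s within {0..t})"
        using t by (intro has_mat_derivative_subset[OF deriv]) auto
    qed (use t F D in auto)
    moreover have "dual_norm n (F t) \<le> dual_norm n (F 0) + dual_norm n (F t - F 0)"
    proof -
      have "F t = F 0 + (F t - F 0)" using F[OF t] F[of 0] T by (intro eq_matI) auto
      thus ?thesis using dual_norm_add[of "F 0" n "F t - F 0"] F[OF t] F[of 0] T by simp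
    qed
    ultimately have "dual_norm n (F t) \<le> dual_norm n (F 0) + b / 2 * exp (2 * M * t)"
      using b0 by simp
    hence "?h t \<le> exp (- (2 * M * t)) * (dual_norm n (F 0) + b / 2 * exp (2 * M * t))"
      by (intro mult_left_mono) auto
    also have "\<dots> = exp (- (2 * M * t)) * dual_norm n (F 0) + b / 2"
      by (simp add: exp_minus field_simps)
    also have "\<dots> \<le> 1 * dual_norm n (F 0) + b / 2"
      using M t T dual_norm_nonneg[OF F[of 0]] by (intro add_right_mono mult_right_mono) auto
    finally show ?thesis by simp
  qed
  hence "b \<le> dual_norm n (F 0) + b / 2"
    unfolding b_def[symmetric] using T by (subst b_def) (rule cSUP_least, auto)
  hence "b \<le> 2 * dual_norm n (F 0)" by simp
  hence "b * exp (2 * M * t) \<le> 2 * dual_norm n (F 0) * exp (2 * M * t)"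
    by (intro mult_right_mono) auto
  from order_trans[OF F_le[OF t] this] show ?thesis by (simp only: mult_ac)
qed

section \<open>The matrix exponential\<close>

lemma op_bound_pow:
  assumes "op_bound n A c"
  shows "op_bound n (A ^\<^sub>m p) (c ^ p)"
proof (induction p)
  case 0
  show ?case using op_bound_one[of n] carrier_matD[OF op_bound_carrier[OF assms]] by simp
next
  case (Suc p)
  show ?case using op_bound_mult[OF Suc assms] by (simp add: mult.commute)
qed

lemma smult_pow_mat:
  fixes A :: "complex mat"
  assumes A: "A \<in> carrier_mat n n"
  shows "(c \<cdot>\<^sub>m A) ^\<^sub>m p = c ^ p \<cdot>\<^sub>m (A ^\<^sub>m p)"
proof (induction p)
  case 0
  show ?case using A by (intro eq_matI) auto
next
  case (Suc p)
  have "(c ^ p \<cdot>\<^sub>m (A ^\<^sub>m p)) * (c \<cdot>\<^sub>m A) = c ^ p \<cdot>\<^sub>m (A ^\<^sub>m p * (c \<cdot>\<^sub>m A))"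
    using A by (intro mult_smult_assoc_mat[of _ n n _ n]) auto
  also have "A ^\<^sub>m p * (c \<cdot>\<^sub>m A) = c \<cdot>\<^sub>m (A ^\<^sub>m p * A)"
    using A by (intro mult_smult_distrib[of _ n n _ n]) auto
  also have "c ^ p \<cdot>\<^sub>m (c \<cdot>\<^sub>m (A ^\<^sub>m p * A)) = c ^ Suc p \<cdot>\<^sub>m (A ^\<^sub>m Suc p)"
    by (intro eq_matI) auto
  finally have "(c ^ p \<cdot>\<^sub>m (A ^\<^sub>m p)) * (c \<cdot>\<^sub>m A) = c ^ Suc p \<cdot>\<^sub>m (A ^\<^sub>m Suc p)" .
  thus ?case using Suc by simp
qed

lemma pow_mat_commute:
  assumes A: "A \<in> carrier_mat n n"
  shows "A * A ^\<^sub>m p = A ^\<^sub>m p * A"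
proof (induction p)
  case 0
  show ?case using A by simp
next
  case (Suc p)
  have "A * (A ^\<^sub>m p * A) = A * A ^\<^sub>m p * A"
    using A by (simp add: square_mat_assoc[of _ n])
  thus ?case using Suc by simp
qed

lemma summable_pow_mat_entry:
  fixes A :: "complex mat"
  assumes A: "A \<in> carrier_mat n n" and ij: "i < n" "j < n"
  shows "summable (\<lambda>p. (A ^\<^sub>m p) $$ (i, j) / fact p * z ^ p)"
proof (rule summable_comparison_test')
  let ?c = "trace_norm A"
  show "summable (\<lambda>p. (?c * cmod z) ^ p /\<^sub>R fact p)" by (rule summable_exp_generic)
  fix p :: nat
  have "cmod ((A ^\<^sub>m p) $$ (i, j)) \<le> ?c ^ p"
    by (rule op_bound_index_le[OF op_bound_pow[OF op_bound_trace_norm[OF A]] ij])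
  hence "cmod ((A ^\<^sub>m p) $$ (i, j)) * cmod z ^ p \<le> ?c ^ p * cmod z ^ p"
    by (rule mult_right_mono) simp
  thus "norm ((A ^\<^sub>m p) $$ (i, j) / fact p * z ^ p) \<le> (?c * cmod z) ^ p /\<^sub>R fact p"
    by (simp add: norm_mult norm_divide norm_power power_mult_distrib field_simps)
qed

lemma mat_exp_carrier [simp]: "A \<in> carrier_mat n n \<Longrightarrow> mat_exp A \<in> carrier_mat n n"
  by (simp add: mat_exp_def)

lemma index_mat_exp_smult:
  assumes A: "A \<in> carrier_mat n n" and ij: "i < n" "j < n"
  shows "mat_exp (z \<cdot>\<^sub>m A) $$ (i, j) = (\<Sum>p. (A ^\<^sub>m p) $$ (i, j) / fact p * z ^ p)"
  using A ij by (simp add: mat_exp_def smult_pow_mat[OF A] carrier_matD[OF pow_carrier_mat[OF A]] mult.commute del: pow_mat.simps)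

lemma mat_exp_sums:
  assumes A: "A \<in> carrier_mat n n" and ij: "i < n" "j < n"
  shows "(\<lambda>p. (A ^\<^sub>m p) $$ (i, j) / fact p * z ^ p) sums mat_exp (z \<cdot>\<^sub>m A) $$ (i, j)"
  unfolding index_mat_exp_smult[OF assms] by (rule summable_sums[OF summable_pow_mat_entry[OF assms]])

lemma mat_exp_mult_sums:
  assumes A: "A \<in> carrier_mat n n" and ij: "i < n" "j < n"
  shows "(\<lambda>p. (A ^\<^sub>m p * A) $$ (i, j) / fact p * z ^ p) sums (mat_exp (z \<cdot>\<^sub>m A) * A) $$ (i, j)"
    and "(\<lambda>p. (A ^\<^sub>m p * A) $$ (i, j) / fact p * z ^ p) sums (A * mat_exp (z \<cdot>\<^sub>m A)) $$ (i, j)"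
proof -
  have E: "mat_exp (z \<cdot>\<^sub>m A) \<in> carrier_mat n n" using A by simp
  have P: "A ^\<^sub>m p \<in> carrier_mat n n" for p using A by simp
  have "(\<lambda>p. \<Sum>l<n. (A ^\<^sub>m p) $$ (i, l) / fact p * z ^ p * A $$ (l, j))
      sums (\<Sum>l<n. mat_exp (z \<cdot>\<^sub>m A) $$ (i, l) * A $$ (l, j))"
    by (intro sums_sum sums_mult2 mat_exp_sums[OF A]) (use ij in auto)
  thus "(\<lambda>p. (A ^\<^sub>m p * A) $$ (i, j) / fact p * z ^ p) sums (mat_exp (z \<cdot>\<^sub>m A) * A) $$ (i, j)"
    unfolding index_mult_mat_sum[OF E A ij] index_mult_mat_sum[OF P A ij]
    by (simp add: sum_divide_distrib sum_distrib_right sum_distrib_left mult_ac)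
  have "(\<lambda>p. \<Sum>l<n. A $$ (i, l) * ((A ^\<^sub>m p) $$ (l, j) / fact p * z ^ p))
      sums (\<Sum>l<n. A $$ (i, l) * mat_exp (z \<cdot>\<^sub>m A) $$ (l, j))"
    by (intro sums_sum sums_mult mat_exp_sums[OF A]) (use ij in auto)
  thus "(\<lambda>p. (A ^\<^sub>m p * A) $$ (i, j) / fact p * z ^ p) sums (A * mat_exp (z \<cdot>\<^sub>m A)) $$ (i, j)"
    unfolding pow_mat_commute[OF A, symmetric] index_mult_mat_sum[OF A E ij] index_mult_mat_sum[OF A P ij]
    by (simp add: sum_divide_distrib sum_distrib_right sum_distrib_left mult_ac)
qed

lemma mat_exp_commute:
  assumes A: "A \<in> carrier_mat n n"
  shows "mat_exp (z \<cdot>\<^sub>m A) * A = A * mat_exp (z \<cdot>\<^sub>m A)"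
proof (rule eq_matI)
  fix i j assume "i < dim_row (A * mat_exp (z \<cdot>\<^sub>m A))" "j < dim_col (A * mat_exp (z \<cdot>\<^sub>m A))"
  hence "i < n" "j < n" using A carrier_matD[OF mat_exp_carrier[of "z \<cdot>\<^sub>m A" n]] by auto
  from mat_exp_mult_sums[OF A this]
  show "(mat_exp (z \<cdot>\<^sub>m A) * A) $$ (i, j) = (A * mat_exp (z \<cdot>\<^sub>m A)) $$ (i, j)"
    by (rule sums_unique2)
qed (use A in \<open>auto simp: mat_exp_def\<close>)

lemma mat_exp_zero: "A \<in> carrier_mat n n \<Longrightarrow> mat_exp (0 \<cdot>\<^sub>m A) = 1\<^sub>m n"
proof (rule eq_matI)
  assume A: "A \<in> carrier_mat n n"
  fix i j assume "i < dim_row (1\<^sub>m n :: complex mat)" "j < dim_col (1\<^sub>m n :: complex mat)"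
  hence ij: "i < n" "j < n" by auto
  have "mat_exp (0 \<cdot>\<^sub>m A) $$ (i, j) = (\<Sum>p. (A ^\<^sub>m p) $$ (i, j) / fact p * 0 ^ p)"
    by (rule index_mat_exp_smult[OF A ij])
  also have "\<dots> = (A ^\<^sub>m 0) $$ (i, j)" by (subst powser_zero) simp
  finally show "mat_exp (0 \<cdot>\<^sub>m A) $$ (i, j) = 1\<^sub>m n $$ (i, j)" using A by simp
qed (auto simp: mat_exp_def)

text \<open>Each entry of \<open>exp (z A)\<close> is an everywhere convergent power series in the complex variable \<open>z\<close>, which is
  differentiated term by term and then restricted to the real line.\<close>
lemma has_mat_derivative_mat_exp:
  assumes A: "A \<in> carrier_mat n n"
  shows "has_mat_derivative (\<lambda>s. mat_exp (of_real s \<cdot>\<^sub>m A)) (mat_exp (of_real t \<cdot>\<^sub>m A) * A) (at t within S)"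
proof (rule has_mat_derivativeI[of _ n])
  fix i j assume ij: "i < n" "j < n"
  let ?c = "\<lambda>p. (A ^\<^sub>m p) $$ (i, j) / fact p"
  have "diffs ?c = (\<lambda>p. (A ^\<^sub>m p * A) $$ (i, j) / fact p)"
    by (rule ext) (simp add: diffs_def del: of_nat_Suc)
  moreover have "((\<lambda>z. \<Sum>p. ?c p * z ^ p) has_field_derivative (\<Sum>p. diffs ?c p * of_real t ^ p)) (at (complex_of_real t))"
    by (rule termdiffs_strong_converges_everywhere[OF summable_pow_mat_entry[OF A ij]])
  ultimately have "((\<lambda>z. \<Sum>p. ?c p * z ^ p) has_field_derivative (mat_exp (of_real t \<cdot>\<^sub>m A) * A) $$ (i, j)) (at (complex_of_real t))"
    using sums_unique[OF mat_exp_mult_sums(1)[OF A ij]] by simp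
  hence "((\<lambda>s. \<Sum>p. ?c p * of_real s ^ p) has_vector_derivative (mat_exp (of_real t \<cdot>\<^sub>m A) * A) $$ (i, j)) (at t within S)"
    by (rule has_vector_derivative_real_field)
  thus "((\<lambda>s. mat_exp (of_real s \<cdot>\<^sub>m A) $$ (i, j)) has_vector_derivative (mat_exp (of_real t \<cdot>\<^sub>m A) * A) $$ (i, j)) (at t within S)"
    by (simp only: index_mat_exp_smult[OF A ij])
qed (use A in simp)

section \<open>The Lindblad generator\<close>

lemma mat_sum_mult_right:
  assumes "\<And>k. k \<in> S \<Longrightarrow> F k \<in> carrier_mat n n" "R \<in> carrier_mat n n"
  shows "mat_sum n F S * R = mat_sum n (\<lambda>k. F k * R) S"
proof (rule eq_matI)
  fix i j assume "i < dim_row (mat_sum n (\<lambda>k. F k * R) S)" "j < dim_col (mat_sum n (\<lambda>k. F k * R) S)"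
  hence ij: "i < n" "j < n" by auto
  have "(mat_sum n F S * R) $$ (i, j) = (\<Sum>l<n. \<Sum>k\<in>S. F k $$ (i, l) * R $$ (l, j))"
    unfolding index_mult_mat_sum[OF mat_sum_carrier assms(2) ij]
    using ij by (intro sum.cong) (auto simp: mat_sum_def sum_distrib_right)
  also have "\<dots> = (\<Sum>k\<in>S. \<Sum>l<n. F k $$ (i, l) * R $$ (l, j))" by (rule sum.swap)
  also have "\<dots> = (\<Sum>k\<in>S. (F k * R) $$ (i, j))"
    by (intro sum.cong) (simp_all add: index_mult_mat_sum[OF assms ij] del: index_mult_mat)
  finally show "(mat_sum n F S * R) $$ (i, j) = mat_sum n (\<lambda>k. F k * R) S $$ (i, j)"
    using ij by (simp add: mat_sum_def)
qed (use assms in auto)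

lemma mat_sum_mult_left:
  assumes "\<And>k. k \<in> S \<Longrightarrow> F k \<in> carrier_mat n n" "R \<in> carrier_mat n n"
  shows "R * mat_sum n F S = mat_sum n (\<lambda>k. R * F k) S"
proof (rule eq_matI)
  fix i j assume "i < dim_row (mat_sum n (\<lambda>k. R * F k) S)" "j < dim_col (mat_sum n (\<lambda>k. R * F k) S)"
  hence ij: "i < n" "j < n" by auto
  have "(R * mat_sum n F S) $$ (i, j) = (\<Sum>l<n. \<Sum>k\<in>S. R $$ (i, l) * F k $$ (l, j))"
    unfolding index_mult_mat_sum[OF assms(2) mat_sum_carrier ij]
    using ij by (intro sum.cong) (auto simp: mat_sum_def sum_distrib_left)
  also have "\<dots> = (\<Sum>k\<in>S. \<Sum>l<n. R $$ (i, l) * F k $$ (l, j))" by (rule sum.swap)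
  also have "\<dots> = (\<Sum>k\<in>S. (R * F k) $$ (i, j))"
    by (intro sum.cong) (simp_all add: index_mult_mat_sum[OF assms(2,1) ij] del: index_mult_mat)
  finally show "(R * mat_sum n F S) $$ (i, j) = mat_sum n (\<lambda>k. R * F k) S $$ (i, j)"
    using ij by (simp add: mat_sum_def)
qed (use assms in auto)

lemma mat_adjoint_mat_sum:
  assumes "\<And>k. k \<in> S \<Longrightarrow> F k \<in> carrier_mat n n"
  shows "mat_adjoint (mat_sum n F S) = mat_sum n (\<lambda>k. mat_adjoint (F k)) S"
proof (rule eq_matI)
  fix i j assume "i < dim_row (mat_sum n (\<lambda>k. mat_adjoint (F k)) S)" "j < dim_col (mat_sum n (\<lambda>k. mat_adjoint (F k)) S)"
  hence ij: "i < n" "j < n" by auto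
  have "mat_adjoint (F k) $$ (i, j) = cnj (F k $$ (j, i))" if "k \<in> S" for k
    using assms[OF that] ij by simp
  thus "mat_adjoint (mat_sum n F S) $$ (i, j) = mat_sum n (\<lambda>k. mat_adjoint (F k)) S $$ (i, j)"
    using ij by (simp add: mat_sum_def)
qed auto

locale lindblad_data =
  fixes m K :: nat and H :: "complex mat" and L :: "nat \<Rightarrow> complex mat" and \<gamma> :: "nat \<Rightarrow> real"
  assumes H: "H \<in> carrier_mat m m" "mat_hermitian H"
    and L: "\<And>k. k \<in> {1..K} \<Longrightarrow> L k \<in> carrier_mat m m"
    and \<gamma>: "\<And>k. k \<in> {1..K} \<Longrightarrow> 0 \<le> \<gamma> k"
begin

abbreviation "A \<equiv> drift m K H L \<gamma>"

definition jump :: "complex mat \<Rightarrow> complex mat" where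
  "jump R = mat_sum m (\<lambda>k. of_real (\<gamma> k) \<cdot>\<^sub>m (L k * R * mat_adjoint (L k))) {1..K}"

definition damping :: "complex mat" where
  "damping = mat_sum m (\<lambda>k. of_real (\<gamma> k) \<cdot>\<^sub>m (mat_adjoint (L k) * L k)) {1..K}"

lemma drift_carrier [simp]: "A \<in> carrier_mat m m"
  using H by (simp add: drift_def)

lemma jump_carrier [simp]: "jump R \<in> carrier_mat m m" by (simp add: jump_def)

lemma damping_carrier [simp]: "damping \<in> carrier_mat m m" by (simp add: damping_def)

text \<open>The part of the generator that acts by multiplication from one side splits into Hamiltonian and damping, so
  that \<open>A\<^sup>*\<close> differs from \<open>A\<close> only in the sign of the Hamiltonian part.\<close>
lemma drift_eq: "A = (- \<i>) \<cdot>\<^sub>m H - (1/2) \<cdot>\<^sub>m damping"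
  by (simp add: drift_def damping_def)

lemma LL_carrier: "k \<in> {1..K} \<Longrightarrow> mat_adjoint (L k) * L k \<in> carrier_mat m m"
  using L[of k] by simp

lemma damping_adjoint: "mat_adjoint damping = damping"
proof -
  have "mat_adjoint (of_real (\<gamma> k) \<cdot>\<^sub>m (mat_adjoint (L k) * L k)) = of_real (\<gamma> k) \<cdot>\<^sub>m (mat_adjoint (L k) * L k)"
    if "k \<in> {1..K}" for k
    using L[OF that] by (simp add: mat_adjoint_smult mat_adjoint_mult[of _ m m _ m])
  moreover have "mat_adjoint damping = mat_sum m (\<lambda>k. mat_adjoint (of_real (\<gamma> k) \<cdot>\<^sub>m (mat_adjoint (L k) * L k))) {1..K}"
    unfolding damping_def using LL_carrier by (intro mat_adjoint_mat_sum) auto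
  ultimately show ?thesis by (simp add: damping_def mat_sum_def)
qed

lemma drift_adjoint: "mat_adjoint A = \<i> \<cdot>\<^sub>m H - (1/2) \<cdot>\<^sub>m damping"
  using H unfolding drift_eq
  by (simp add: mat_adjoint_minus[of _ m m] mat_adjoint_smult damping_adjoint mat_hermitian_def)

lemma index_jump:
  assumes R: "R \<in> carrier_mat m m" and ij: "i < m" "j < m"
  shows "jump R $$ (i, j) = (\<Sum>k\<in>{1..K}. of_real (\<gamma> k) * (L k * R * mat_adjoint (L k)) $$ (i, j))"
proof -
  have "(of_real (\<gamma> k) \<cdot>\<^sub>m (L k * R * mat_adjoint (L k))) $$ (i, j)
      = of_real (\<gamma> k) * (L k * R * mat_adjoint (L k)) $$ (i, j)" if "k \<in> {1..K}" for k
    using R ij L[OF that] by (simp del: index_mult_mat(1))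
  thus ?thesis using ij by (simp add: jump_def mat_sum_def del: index_mult_mat(1))
qed

text \<open>The commutator and the anticommutators combine into \<open>A R + R A\<^sup>*\<close>, which leaves the jump term.\<close>
lemma lindblad_rhs_eq:
  assumes R: "R \<in> carrier_mat m m"
  shows "lindblad_rhs m K H L \<gamma> R = A * R + R * mat_adjoint A + jump R"
proof (rule eq_matI)
  have car: "A * R + R * mat_adjoint A + jump R \<in> carrier_mat m m" using R by simp
  fix i j assume "i < dim_row (A * R + R * mat_adjoint A + jump R)"
    "j < dim_col (A * R + R * mat_adjoint A + jump R)"
  hence ij: "i < m" "j < m" unfolding carrier_matD[OF car] .
  let ?Q = "\<lambda>k. mat_adjoint (L k) * L k"
  have GR: "(damping * R) $$ (i, j) = (\<Sum>k\<in>{1..K}. of_real (\<gamma> k) * (?Q k * R) $$ (i, j))"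
  proof -
    have "damping * R = mat_sum m (\<lambda>k. of_real (\<gamma> k) \<cdot>\<^sub>m ?Q k * R) {1..K}"
      unfolding damping_def using R LL_carrier by (intro mat_sum_mult_right) auto
    moreover have "(of_real (\<gamma> k) \<cdot>\<^sub>m ?Q k * R) $$ (i, j) = of_real (\<gamma> k) * (?Q k * R) $$ (i, j)"
      if "k \<in> {1..K}" for k
      using mult_smult_assoc_mat[OF LL_carrier[OF that] R] ij R L[OF that] by simp
    ultimately show ?thesis using ij by (simp add: mat_sum_def)
  qed
  have RG: "(R * damping) $$ (i, j) = (\<Sum>k\<in>{1..K}. of_real (\<gamma> k) * (R * ?Q k) $$ (i, j))"
  proof -
    have "R * damping = mat_sum m (\<lambda>k. R * (of_real (\<gamma> k) \<cdot>\<^sub>m ?Q k)) {1..K}"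
      unfolding damping_def using R LL_carrier by (intro mat_sum_mult_left) auto
    moreover have "(R * (of_real (\<gamma> k) \<cdot>\<^sub>m ?Q k)) $$ (i, j) = of_real (\<gamma> k) * (R * ?Q k) $$ (i, j)"
      if "k \<in> {1..K}" for k
      using mult_smult_distrib[OF R LL_carrier[OF that]] ij R L[OF that] by simp
    ultimately show ?thesis using ij by (simp add: mat_sum_def)
  qed
  have AR: "(A * R) $$ (i, j) = - \<i> * (H * R) $$ (i, j) - (1/2) * (damping * R) $$ (i, j)"
  proof -
    have "A * R = (- \<i>) \<cdot>\<^sub>m (H * R) - (1/2) \<cdot>\<^sub>m (damping * R)"
      unfolding drift_eq using H R by (simp add: minus_mult_distrib_mat[of _ m m _ _ m] mult_smult_assoc_mat[of _ m m _ m])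
    thus ?thesis using H R ij carrier_matD[OF damping_carrier] by simp
  qed
  have RA: "(R * mat_adjoint A) $$ (i, j) = \<i> * (R * H) $$ (i, j) - (1/2) * (R * damping) $$ (i, j)"
  proof -
    have "R * mat_adjoint A = \<i> \<cdot>\<^sub>m (R * H) - (1/2) \<cdot>\<^sub>m (R * damping)"
      unfolding drift_adjoint using H R by (simp add: mult_minus_distrib_mat[of _ m m _ m] mult_smult_distrib[of _ m m _ m])
    thus ?thesis using H R ij carrier_matD[OF damping_carrier] by simp
  qed
  have entry: "(of_real (\<gamma> k) \<cdot>\<^sub>m (L k * R * mat_adjoint (L k) - (1/2) \<cdot>\<^sub>m anticommutator (?Q k) R)) $$ (i, j)
      = of_real (\<gamma> k) * (L k * R * mat_adjoint (L k)) $$ (i, j)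
        - (1/2) * (of_real (\<gamma> k) * (?Q k * R) $$ (i, j)) - (1/2) * (of_real (\<gamma> k) * (R * ?Q k) $$ (i, j))"
    if "k \<in> {1..K}" for k
    using ij R L[OF that] by (simp add: anticommutator_def right_diff_distrib distrib_left del: index_mult_mat(1))
  note jump = index_jump[OF R ij]
  have "lindblad_rhs m K H L \<gamma> R $$ (i, j) = - \<i> * ((H * R) $$ (i, j) - (R * H) $$ (i, j))
      + (\<Sum>k\<in>{1..K}. of_real (\<gamma> k) * (L k * R * mat_adjoint (L k)) $$ (i, j)
        - (1/2) * (of_real (\<gamma> k) * (?Q k * R) $$ (i, j)) - (1/2) * (of_real (\<gamma> k) * (R * ?Q k) $$ (i, j)))"
    using ij H R entry
    by (simp add: lindblad_rhs_def commutator_def mat_sum_def del: index_mult_mat(1))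
  also have "\<dots> = (A * R) $$ (i, j) + (R * mat_adjoint A) $$ (i, j) + jump R $$ (i, j)"
    unfolding AR RA GR RG jump by (simp add: sum_subtractf sum_distrib_left algebra_simps del: index_mult_mat(1))
  also have "\<dots> = (A * R + R * mat_adjoint A + jump R) $$ (i, j)"
    using ij R carrier_matD[OF drift_carrier] carrier_matD[OF jump_carrier[of R]] by (simp del: index_mult_mat(1))
  finally show "lindblad_rhs m K H L \<gamma> R $$ (i, j) = (A * R + R * mat_adjoint A + jump R) $$ (i, j)" .
qed (use H R in \<open>auto simp: lindblad_rhs_def commutator_def jump_def\<close>)

lemma lindblad_rhs_carrier [simp]:
  "R \<in> carrier_mat m m \<Longrightarrow> lindblad_rhs m K H L \<gamma> R \<in> carrier_mat m m"
  by (simp add: lindblad_rhs_eq)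

lemma jump_diff:
  assumes "R \<in> carrier_mat m m" "S \<in> carrier_mat m m"
  shows "jump (R - S) = jump R - jump S"
proof (rule eq_matI)
  fix i j assume "i < dim_row (jump R - jump S)" "j < dim_col (jump R - jump S)"
  hence ij: "i < m" "j < m" by (auto simp: jump_def)
  have "(of_real (\<gamma> k) \<cdot>\<^sub>m (L k * (R - S) * mat_adjoint (L k))) $$ (i, j)
      = (of_real (\<gamma> k) \<cdot>\<^sub>m (L k * R * mat_adjoint (L k))) $$ (i, j)
        - (of_real (\<gamma> k) \<cdot>\<^sub>m (L k * S * mat_adjoint (L k))) $$ (i, j)" if "k \<in> {1..K}" for k
  proof -
    have "L k * (R - S) * mat_adjoint (L k) = L k * R * mat_adjoint (L k) - L k * S * mat_adjoint (L k)"
      using assms L[OF that]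
      by (simp add: mult_minus_distrib_mat[of _ m m _ m] minus_mult_distrib_mat[of _ m m _ _ m])
    thus ?thesis using ij L[OF that] assms by (simp add: right_diff_distrib del: index_mult_mat(1))
  qed
  thus "jump (R - S) $$ (i, j) = (jump R - jump S) $$ (i, j)"
    using ij by (simp add: jump_def mat_sum_def sum_subtractf del: index_mult_mat(1))
qed (auto simp: jump_def)

lemma lindblad_rhs_diff:
  assumes R: "R \<in> carrier_mat m m" and S: "S \<in> carrier_mat m m"
  shows "lindblad_rhs m K H L \<gamma> (R - S) = lindblad_rhs m K H L \<gamma> R - lindblad_rhs m K H L \<gamma> S"
proof -
  have "A * (R - S) = A * R - A * S" "(R - S) * mat_adjoint A = R * mat_adjoint A - S * mat_adjoint A"
    using R S by (auto simp: mult_minus_distrib_mat[of _ m m _ m] minus_mult_distrib_mat[of _ m m _ _ m])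
  note parts = this jump_diff[OF R S]
  have regroup: "X1 - X2 + (Y1 - Y2) + (Z1 - Z2) = X1 + Y1 + Z1 - (X2 + Y2 + Z2)"
    if "X1 \<in> carrier_mat m m" "X2 \<in> carrier_mat m m" "Y1 \<in> carrier_mat m m" "Y2 \<in> carrier_mat m m"
      "Z1 \<in> carrier_mat m m" "Z2 \<in> carrier_mat m m" for X1 X2 Y1 Y2 Z1 Z2 :: "complex mat"
    using that by (intro eq_matI) auto
  show ?thesis
    unfolding lindblad_rhs_eq[OF R] lindblad_rhs_eq[OF S] lindblad_rhs_eq[OF square_mat_minus_closed[OF R S]] parts
    by (rule regroup) (use R S in simp_all)
qed

definition C\<^sub>1 :: real where "C\<^sub>1 = (\<Sum>k=1..K. \<gamma> k * (trace_norm (L k))\<^sup>2)"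
definition C\<^sub>2 :: real where "C\<^sub>2 = trace_norm A"

lemma dual_norm_drift_le:
  assumes R: "R \<in> carrier_mat m m"
  shows "dual_norm m (A * R + R * mat_adjoint A) \<le> 2 * C\<^sub>2 * dual_norm m R"
proof -
  have opA: "op_bound m A C\<^sub>2" unfolding C\<^sub>2_def by (rule op_bound_trace_norm) simp
  have "dual_norm m (A * R * 1\<^sub>m m) \<le> C\<^sub>2 * 1 * dual_norm m R"
    by (rule dual_norm_mult_both[OF R opA op_bound_one])
  moreover have "dual_norm m (1\<^sub>m m * R * mat_adjoint A) \<le> 1 * C\<^sub>2 * dual_norm m R"
    by (rule dual_norm_mult_both[OF R op_bound_one op_bound_adjoint[OF opA]])
  moreover have "dual_norm m (A * R + R * mat_adjoint A) \<le> dual_norm m (A * R) + dual_norm m (R * mat_adjoint A)"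
    using R by (intro dual_norm_add) simp_all
  ultimately show ?thesis using R by simp
qed

lemma dual_norm_jump_le:
  assumes R: "R \<in> carrier_mat m m"
  shows "dual_norm m (jump R) \<le> C\<^sub>1 * dual_norm m R"
proof -
  have "dual_norm m (jump R) \<le> (\<Sum>k\<in>{1..K}. dual_norm m (of_real (\<gamma> k) \<cdot>\<^sub>m (L k * R * mat_adjoint (L k))))"
    unfolding jump_def using L R by (intro dual_norm_mat_sum) auto
  also have "\<dots> \<le> (\<Sum>k\<in>{1..K}. \<gamma> k * (trace_norm (L k))\<^sup>2 * dual_norm m R)"
  proof (rule sum_mono)
    fix k assume k: "k \<in> {1..K}"
    have "dual_norm m (of_real (\<gamma> k) \<cdot>\<^sub>m (L k * R * mat_adjoint (L k)))
        \<le> cmod (of_real (\<gamma> k)) * dual_norm m (L k * R * mat_adjoint (L k))"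
      using L[OF k] R by (intro dual_norm_smult) simp
    also have "\<dots> = \<gamma> k * dual_norm m (L k * R * mat_adjoint (L k))" using \<gamma>[OF k] by simp
    also have "\<dots> \<le> \<gamma> k * (trace_norm (L k) * trace_norm (L k) * dual_norm m R)"
      by (intro mult_left_mono dual_norm_mult_both[OF R] op_bound_adjoint op_bound_trace_norm L[OF k] \<gamma>[OF k])
    finally show "dual_norm m (of_real (\<gamma> k) \<cdot>\<^sub>m (L k * R * mat_adjoint (L k)))
        \<le> \<gamma> k * (trace_norm (L k))\<^sup>2 * dual_norm m R" by (simp add: power2_eq_square mult_ac)
  qed
  also have "\<dots> = C\<^sub>1 * dual_norm m R" by (simp add: C\<^sub>1_def sum_distrib_right)
  finally show ?thesis .
qed

lemma C_nonneg: "0 \<le> C\<^sub>1" "0 \<le> C\<^sub>2"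
proof -
  show "0 \<le> C\<^sub>1" unfolding C\<^sub>1_def by (intro sum_nonneg mult_nonneg_nonneg \<gamma>) auto
  show "0 \<le> C\<^sub>2" unfolding C\<^sub>2_def using op_bound_nonneg[OF op_bound_trace_norm[OF drift_carrier]] .
qed

text \<open>The generator is bounded in the norm that measures the error, with a bound free of the dimension.\<close>
lemma dual_norm_lindblad_le:
  assumes R: "R \<in> carrier_mat m m"
  shows "dual_norm m (lindblad_rhs m K H L \<gamma> R) \<le> (2 * C\<^sub>2 + C\<^sub>1) * dual_norm m R"
proof -
  have "dual_norm m (lindblad_rhs m K H L \<gamma> R) \<le> dual_norm m (A * R + R * mat_adjoint A) + dual_norm m (jump R)"
    unfolding lindblad_rhs_eq[OF R] using R by (intro dual_norm_add) simp_all
  thus ?thesis using dual_norm_drift_le[OF R] dual_norm_jump_le[OF R] by (simp add: distrib_right)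
qed

section \<open>The scheme as a curve in the step length\<close>

text \<open>The jump-free part of one step of length \<open>s\<close>, which solves \<open>X' = A X + X A\<^sup>*\<close>.\<close>
definition damped_flow :: "complex mat \<Rightarrow> real \<Rightarrow> complex mat" where
  "damped_flow R s = mat_exp (of_real s \<cdot>\<^sub>m A) * R * mat_exp (of_real s \<cdot>\<^sub>m mat_adjoint A)"

lemma damped_flow_carrier [simp]: "R \<in> carrier_mat m m \<Longrightarrow> damped_flow R s \<in> carrier_mat m m"
  by (simp add: damped_flow_def)

lemma damped_flow_0: "R \<in> carrier_mat m m \<Longrightarrow> damped_flow R 0 = R"
  by (simp add: damped_flow_def mat_exp_zero[of _ m])

lemma damped_flow_derivative:
  assumes R: "R \<in> carrier_mat m m"
  shows "has_mat_derivative (damped_flow R) (A * damped_flow R t + damped_flow R t * mat_adjoint A) (at t within S)"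
proof -
  let ?E = "\<lambda>s. mat_exp (of_real s \<cdot>\<^sub>m A)" and ?G = "\<lambda>s. mat_exp (of_real s \<cdot>\<^sub>m mat_adjoint A)"
  have ER: "has_mat_derivative (\<lambda>s. ?E s * R) (?E t * 0\<^sub>m m m + ?E t * A * R) (at t within S)"
    using R by (intro has_mat_derivative_mult[of _ _ _ _ _ _ m] has_mat_derivative_mat_exp[of _ m] has_mat_derivative_const) simp_all
  have "has_mat_derivative (\<lambda>s. ?E s * R * ?G s)
      (?E t * R * (?G t * mat_adjoint A) + (?E t * 0\<^sub>m m m + ?E t * A * R) * ?G t) (at t within S)"
    using R by (intro has_mat_derivative_mult[of _ _ _ _ _ _ m] has_mat_derivative_mat_exp[of _ m] ER) simp_all
  moreover have "?E t * R * (?G t * mat_adjoint A) + (?E t * 0\<^sub>m m m + ?E t * A * R) * ?G t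
      = A * damped_flow R t + damped_flow R t * mat_adjoint A"
  proof -
    have "?E t * 0\<^sub>m m m + ?E t * A * R = A * ?E t * R"
      using R right_mult_zero_mat[of "?E t" m m m]
      by (simp add: mat_exp_commute[of _ m] square_mat_assoc[of _ m])
    moreover have "?E t * R * (?G t * mat_adjoint A) = damped_flow R t * mat_adjoint A"
      "A * ?E t * R * ?G t = A * damped_flow R t"
      unfolding damped_flow_def using R by (simp_all add: square_mat_assoc[of _ m])
    ultimately show ?thesis using R comm_add_mat[of "damped_flow R t * mat_adjoint A" m m "A * damped_flow R t"] by simp
  qed
  ultimately show ?thesis unfolding damped_flow_def[abs_def] by simp
qed

abbreviation "euler_step s R \<equiv> exp_euler_step m K H L \<gamma> s R"

lemma euler_step_carrier [simp]: "R \<in> carrier_mat m m \<Longrightarrow> euler_step s R \<in> carrier_mat m m"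
  by (simp add: exp_euler_step_def Let_def)

lemma index_euler_step:
  assumes R: "R \<in> carrier_mat m m" and ij: "i < m" "j < m"
  shows "euler_step s R $$ (i, j) = damped_flow R s $$ (i, j)
    + (\<Sum>k\<in>{1..K}. of_real (\<gamma> k) *
        integral {0..s} (\<lambda>r. (L k * damped_flow R r * mat_adjoint (L k)) $$ (i, j)))"
proof -
  have "L k * mat_exp (of_real r \<cdot>\<^sub>m A) * R * mat_exp (of_real r \<cdot>\<^sub>m mat_adjoint A) * mat_adjoint (L k)
      = L k * damped_flow R r * mat_adjoint (L k)" if "k \<in> {1..K}" for k r
    using L[OF that] R by (simp add: damped_flow_def square_mat_assoc[of _ m])
  thus ?thesis
    using ij R carrier_matD[OF damped_flow_carrier[OF R]]
    by (simp add: exp_euler_step_def Let_def mat_sum_def mat_integral_def flip: damped_flow_def del: index_mult_mat(1))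
qed

lemma euler_step_0:
  assumes R: "R \<in> carrier_mat m m"
  shows "euler_step 0 R = R"
proof (rule eq_matI)
  fix i j assume "i < dim_row R" "j < dim_col R"
  hence "i < m" "j < m" using R by auto
  thus "euler_step 0 R $$ (i, j) = R $$ (i, j)"
    by (simp add: index_euler_step[OF R] damped_flow_0[OF R])
qed (use R carrier_matD[OF euler_step_carrier[OF R]] in auto)

text \<open>The scheme, as a function of the step length, follows the Lindblad vector field evaluated along the
  damped flow instead of along the curve itself: the flow contributes \<open>A X + X A\<^sup>*\<close> and the fundamental theorem of
  calculus contributes the jump term.\<close>
lemma euler_step_derivative:
  assumes R: "R \<in> carrier_mat m m" and t: "t \<in> {0..\<tau>}"
  shows "has_mat_derivative (\<lambda>s. euler_step s R) (lindblad_rhs m K H L \<gamma> (damped_flow R t)) (at t within {0..\<tau>})"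
proof (rule has_mat_derivativeI[of _ m])
  let ?X = "damped_flow R"
  let ?D = "A * ?X t + ?X t * mat_adjoint A"
  have D: "?D \<in> carrier_mat m m" using R by simp
  fix i j assume ij: "i < m" "j < m"
  have int: "((\<lambda>s. integral {0..s} (\<lambda>r. (L k * ?X r * mat_adjoint (L k)) $$ (i, j)))
      has_vector_derivative (L k * ?X t * mat_adjoint (L k)) $$ (i, j)) (at t within {0..\<tau>})"
    if k: "k \<in> {1..K}" for k
  proof (rule integral_has_vector_derivative[OF _ t])
    have "continuous_on {0..\<tau>} (\<lambda>r. ?X r $$ (l, p))" if "l < m" "p < m" for l p
      by (rule has_mat_derivative_continuous_entry[where D = "\<lambda>r. A * ?X r + ?X r * mat_adjoint A" and n = m])
        (use R that damped_flow_derivative in auto)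
    hence "continuous_on {0..\<tau>} (\<lambda>r. \<Sum>p<m. (\<Sum>l<m. L k $$ (i, l) * ?X r $$ (l, p)) * mat_adjoint (L k) $$ (p, j))"
      by (intro continuous_intros) auto
    moreover have "(L k * ?X r * mat_adjoint (L k)) $$ (i, j)
        = (\<Sum>p<m. (\<Sum>l<m. L k $$ (i, l) * ?X r $$ (l, p)) * mat_adjoint (L k) $$ (p, j))" for r
    proof -
      have "(L k * ?X r * mat_adjoint (L k)) $$ (i, j)
          = (\<Sum>p<m. (L k * ?X r) $$ (i, p) * mat_adjoint (L k) $$ (p, j))"
        by (rule index_mult_mat_sum) (use L[OF k] R ij in auto)
      also have "\<dots> = (\<Sum>p<m. (\<Sum>l<m. L k $$ (i, l) * ?X r $$ (l, p)) * mat_adjoint (L k) $$ (p, j))"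
        by (intro sum.cong refl arg_cong2[where f = "(*)"] index_mult_mat_sum) (use L[OF k] R ij in auto)
      finally show ?thesis .
    qed
    ultimately show "continuous_on {0..\<tau>} (\<lambda>r. (L k * ?X r * mat_adjoint (L k)) $$ (i, j))" by simp
  qed
  have "((\<lambda>s. euler_step s R $$ (i, j)) has_vector_derivative
      ?D $$ (i, j) + (\<Sum>k\<in>{1..K}. of_real (\<gamma> k) * (L k * ?X t * mat_adjoint (L k)) $$ (i, j)))
      (at t within {0..\<tau>})"
    unfolding index_euler_step[OF R ij]
    by (intro has_vector_derivative_add has_vector_derivative_sum has_vector_derivative_mult_right int
        has_mat_derivativeD[OF damped_flow_derivative[OF R] D ij])
  moreover have "(\<Sum>k\<in>{1..K}. of_real (\<gamma> k) * (L k * ?X t * mat_adjoint (L k)) $$ (i, j)) = jump (?X t) $$ (i, j)"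
    by (rule index_jump[symmetric]) (use ij R in auto)
  moreover have "?D $$ (i, j) + jump (?X t) $$ (i, j) = lindblad_rhs m K H L \<gamma> (?X t) $$ (i, j)"
    using R ij D carrier_matD[OF jump_carrier[of "?X t"]]
    by (simp add: lindblad_rhs_eq del: index_mult_mat(1))
  ultimately show "((\<lambda>s. euler_step s R $$ (i, j)) has_vector_derivative
      lindblad_rhs m K H L \<gamma> (?X t) $$ (i, j)) (at t within {0..\<tau>})" by simp
qed (use R in simp)

section \<open>Error estimates\<close>

lemma solutionD:
  assumes "lindblad_solution m K H L \<gamma> T \<rho>\<^sub>0 \<rho>"
  shows "\<rho> 0 = \<rho>\<^sub>0" "t \<in> {0..T} \<Longrightarrow> \<rho> t \<in> carrier_mat m m"
    "t \<in> {0..T} \<Longrightarrow> has_mat_derivative \<rho> (lindblad_rhs m K H L \<gamma> (\<rho> t)) (at t within {0..T})"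
  using assms by (auto simp: lindblad_solution_def)

text \<open>\<open>M\<close> bounds the generator and \<open>B\<close> is the resulting growth factor over the whole time interval.\<close>
context
  fixes M T B :: real
  assumes M: "0 < M" "2 * C\<^sub>2 + C\<^sub>1 \<le> M"
    and B: "B = 2 * exp (2 * M * T)"
begin

lemma dual_norm_lindblad_le_M:
  assumes R: "R \<in> carrier_mat m m"
  shows "dual_norm m (lindblad_rhs m K H L \<gamma> R) \<le> M * dual_norm m R"
  using dual_norm_lindblad_le[OF R] mult_right_mono[OF M(2) dual_norm_nonneg[OF R]] by linarith

lemma dual_norm_drift_le_M:
  assumes R: "R \<in> carrier_mat m m"
  shows "dual_norm m (A * R + R * mat_adjoint A) \<le> M * dual_norm m R"
proof -
  have "2 * C\<^sub>2 \<le> M" using M C_nonneg by simp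
  thus ?thesis using dual_norm_drift_le[OF R] mult_right_mono[OF _ dual_norm_nonneg[OF R]] by (meson order_trans)
qed

lemma growth_le_B:
  assumes "t \<le> T" "0 \<le> x"
  shows "2 * exp (2 * M * t) * x \<le> B * x"
  unfolding B using assms M by (intro mult_right_mono) auto

text \<open>A density matrix has trace norm one, which is where the data enter.\<close>
lemma solution_bound:
  assumes sol: "lindblad_solution m K H L \<gamma> T \<rho>\<^sub>0 \<rho>"
    and "mat_psd \<rho>\<^sub>0" "mat_trace \<rho>\<^sub>0 = 1" and t: "t \<in> {0..T}"
  shows "dual_norm m (\<rho> t) \<le> B"
proof -
  have c: "\<rho> 0 \<in> carrier_mat m m" using solutionD(2)[OF sol, of 0] t by simp
  have init: "dual_norm m (\<rho> 0) \<le> 1"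
    using dual_norm_psd_le[OF c] assms solutionD(1)[OF sol] by simp
  have "dual_norm m (\<rho> t) \<le> 2 * exp (2 * M * t) * dual_norm m (\<rho> 0)"
    by (rule dual_norm_gronwall[where D = "\<lambda>t. lindblad_rhs m K H L \<gamma> (\<rho> t)", OF M(1) _ _ _ _ t])
      (use solutionD[OF sol] dual_norm_lindblad_le_M in auto)
  also have "\<dots> \<le> B * dual_norm m (\<rho> 0)" using t dual_norm_nonneg[OF c] by (intro growth_le_B) auto
  also have "\<dots> \<le> B * 1" using init by (intro mult_left_mono) (auto simp: B)
  finally show ?thesis by simp
qed

lemma solution_increment:
  assumes sol: "lindblad_solution m K H L \<gamma> T \<rho>\<^sub>0 \<rho>"
    and "mat_psd \<rho>\<^sub>0" "mat_trace \<rho>\<^sub>0 = 1" and t: "0 \<le> t" "0 \<le> s" "t + s \<le> T"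
  shows "dual_norm m (\<rho> (t + s) - \<rho> t) \<le> s * M * B"
proof -
  have "dual_norm m (\<rho> (t + s) - \<rho> t) \<le> M * B * (t + s) - M * B * t"
  proof (rule dual_norm_mean_value[where D = "\<lambda>t. lindblad_rhs m K H L \<gamma> (\<rho> t)" and \<phi>' = "\<lambda>_. M * B"])
    fix r
    show "((\<lambda>x. M * B * x) has_real_derivative M * B) (at r)" by (auto intro!: derivative_eq_intros)
    assume "t < r" "r < t + s"
    hence r: "r \<in> {0..T}" using t by simp
    show "dual_norm m (lindblad_rhs m K H L \<gamma> (\<rho> r)) \<le> M * B"
      using order_trans[OF dual_norm_lindblad_le_M[OF solutionD(2)[OF sol r]]
          mult_left_mono[OF solution_bound[OF assms(1-3) r], of M]] M by simp
  next
    fix r assume "r \<in> {t..t + s}"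
    hence r: "r \<in> {0..T}" using t by simp
    show "\<rho> r \<in> carrier_mat m m" "lindblad_rhs m K H L \<gamma> (\<rho> r) \<in> carrier_mat m m"
      using solutionD(2)[OF sol r] by simp_all
    show "has_mat_derivative \<rho> (lindblad_rhs m K H L \<gamma> (\<rho> r)) (at r within {t..t + s})"
      by (rule has_mat_derivative_subset[OF solutionD(3)[OF sol r]]) (use t in auto)
  qed (use t in auto)
  thus ?thesis by (simp add: algebra_simps)
qed

lemma damped_flow_bound:
  assumes R: "R \<in> carrier_mat m m" and s: "s \<in> {0..T}"
  shows "dual_norm m (damped_flow R s) \<le> B * dual_norm m R"
proof -
  have "dual_norm m (damped_flow R s) \<le> 2 * exp (2 * M * s) * dual_norm m (damped_flow R 0)"
    by (rule dual_norm_gronwall[where D = "\<lambda>s. A * damped_flow R s + damped_flow R s * mat_adjoint A", OF M(1) _ _ _ _ s])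
      (use R damped_flow_derivative dual_norm_drift_le_M in auto)
  also have "\<dots> \<le> B * dual_norm m (damped_flow R 0)"
    using s R by (intro growth_le_B dual_norm_nonneg) auto
  finally show ?thesis using R by (simp add: damped_flow_0)
qed

lemma damped_flow_increment:
  assumes R: "R \<in> carrier_mat m m" and s: "s \<in> {0..T}"
  shows "dual_norm m (damped_flow R s - R) \<le> s * M * (B * dual_norm m R)"
proof -
  let ?c = "M * (B * dual_norm m R)"
  have "dual_norm m (damped_flow R s - damped_flow R 0) \<le> ?c * s - ?c * 0"
  proof (rule dual_norm_mean_value[where D = "\<lambda>s. A * damped_flow R s + damped_flow R s * mat_adjoint A"
        and \<phi>' = "\<lambda>_. ?c"])
    fix r
    show "((\<lambda>x. ?c * x) has_real_derivative ?c) (at r)" by (auto intro!: derivative_eq_intros)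
    assume "0 < r" "r < s"
    hence r: "r \<in> {0..T}" using s by simp
    show "dual_norm m (A * damped_flow R r + damped_flow R r * mat_adjoint A) \<le> ?c"
      using order_trans[OF dual_norm_drift_le_M[OF damped_flow_carrier[OF R]]
          mult_left_mono[OF damped_flow_bound[OF R r], of M]] M by simp
  next
    fix r
    show "has_mat_derivative (damped_flow R) (A * damped_flow R r + damped_flow R r * mat_adjoint A)
        (at r within {0..s})"
      by (rule damped_flow_derivative[OF R])
  qed (use R s in auto)
  thus ?thesis using R by (simp add: damped_flow_0 algebra_simps)
qed

text \<open>The defect \<open>F s = \<rho> (t + s) - euler_step s R\<close> has derivative \<open>\<L> (\<rho> (t + s) - damped_flow R s)\<close> by linearity of the
  generator \<open>\<L>\<close>.  Both curves stay within \<open>O(\<tau>)\<close> of their initial values \<open>\<rho> t\<close> and \<open>R\<close>, so the derivative is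
  \<open>O(\<tau>)\<close> plus a multiple of the old error \<open>e\<close>, and integrating it over the step gains one more factor \<open>\<tau>\<close>.
  The starting point \<open>R\<close> is arbitrary, so propagation of the old error and the new local error are estimated
  together.\<close>
lemma one_step_error:
  assumes sol: "lindblad_solution m K H L \<gamma> T \<rho>\<^sub>0 \<rho>"
    and "mat_psd \<rho>\<^sub>0" "mat_trace \<rho>\<^sub>0 = 1" and t: "0 \<le> t" "0 \<le> \<tau>" "t + \<tau> \<le> T"
    and R: "R \<in> carrier_mat m m"
  defines "e \<equiv> dual_norm m (\<rho> t - R)"
  shows "dual_norm m (\<rho> (t + \<tau>) - euler_step \<tau> R)
    \<le> e + \<tau> * M * (\<tau> * M * B + e + \<tau> * M * (B * (B + e)))"
proof -
  have tT: "t \<in> {0..T}" using t by simp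
  have \<rho>t: "\<rho> t \<in> carrier_mat m m" by (rule solutionD(2)[OF sol tT])
  have ts: "t + s \<in> {0..T}" "s \<in> {0..T}" if "s \<in> {0..\<tau>}" for s using that t by auto
  have \<rho>c: "\<rho> (t + s) \<in> carrier_mat m m" if "s \<in> {0..\<tau>}" for s
    by (rule solutionD(2)[OF sol ts(1)[OF that]])
  have B0: "0 \<le> B" by (simp add: B)
  have NR: "dual_norm m R \<le> B + e"
  proof -
    have "R = \<rho> t - (\<rho> t - R)" using \<rho>t R by (intro eq_matI) auto
    hence "dual_norm m R \<le> dual_norm m (\<rho> t) + e"
      using dual_norm_diff[of "\<rho> t" m "\<rho> t - R"] \<rho>t R by (simp add: e_def)
    thus ?thesis using solution_bound[OF assms(1-3) tT] by simp
  qed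
  let ?c = "\<tau> * M * B + e + \<tau> * M * (B * (B + e))"
  have gap: "dual_norm m (\<rho> (t + s) - damped_flow R s) \<le> ?c" if s: "s \<in> {0..\<tau>}" for s
  proof -
    let ?u = "\<rho> (t + s) - \<rho> t" and ?v = "\<rho> t - R" and ?w = "damped_flow R s - R"
    have "\<rho> (t + s) - damped_flow R s = (?u + ?v) - ?w"
      using \<rho>c[OF s] \<rho>t R carrier_matD[OF damped_flow_carrier[OF R, of s]] by (intro eq_matI) auto
    hence "dual_norm m (\<rho> (t + s) - damped_flow R s) \<le> dual_norm m (?u + ?v) + dual_norm m ?w"
      using dual_norm_diff[of "?u + ?v" m ?w] \<rho>c[OF s] \<rho>t R by simp
    also have "\<dots> \<le> dual_norm m ?u + dual_norm m ?v + dual_norm m ?w"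
      using dual_norm_add[of ?u m ?v] \<rho>c[OF s] \<rho>t R by simp
    also have "\<dots> \<le> s * M * B + e + s * M * (B * dual_norm m R)"
      unfolding e_def using s t solution_increment[OF assms(1-3) t(1), of s] damped_flow_increment[OF R ts(2)[OF s]]
      by (intro add_mono order_refl) auto
    also have "\<dots> \<le> \<tau> * M * B + e + \<tau> * M * (B * (B + e))"
    proof -
      have "s * M * B \<le> \<tau> * M * B" using s M B0 by (intro mult_right_mono) auto
      moreover have "s * M * (B * dual_norm m R) \<le> \<tau> * M * (B * (B + e))"
        using s M B0 NR dual_norm_nonneg[OF R] by (intro mult_mono mult_left_mono mult_right_mono) auto
      ultimately show ?thesis by simp
    qed
    finally show ?thesis .
  qed
  let ?F = "\<lambda>s. \<rho> (t + s) - euler_step s R"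
  let ?D = "\<lambda>s. lindblad_rhs m K H L \<gamma> (\<rho> (t + s)) - lindblad_rhs m K H L \<gamma> (damped_flow R s)"
  have "dual_norm m (?F \<tau> - ?F 0) \<le> M * ?c * \<tau> - M * ?c * 0"
  proof (rule dual_norm_mean_value[where D = ?D and \<phi>' = "\<lambda>_. M * ?c"])
    fix s
    show "((\<lambda>x. M * ?c * x) has_real_derivative M * ?c) (at s)" by (auto intro!: derivative_eq_intros)
    assume "0 < s" "s < \<tau>"
    hence s: "s \<in> {0..\<tau>}" by simp
    have c: "\<rho> (t + s) - damped_flow R s \<in> carrier_mat m m" using \<rho>c[OF s] R by simp
    have "dual_norm m (?D s) \<le> M * dual_norm m (\<rho> (t + s) - damped_flow R s)"
      using dual_norm_lindblad_le_M[OF c] lindblad_rhs_diff[OF \<rho>c[OF s] damped_flow_carrier[OF R]] by simp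
    also have "\<dots> \<le> M * ?c" using gap[OF s] M by (intro mult_left_mono) auto
    finally show "dual_norm m (?D s) \<le> M * ?c" .
  next
    fix s assume s: "s \<in> {0..\<tau>}"
    show "?F s \<in> carrier_mat m m" "?D s \<in> carrier_mat m m" using \<rho>c[OF s] R by simp_all
    have "has_mat_derivative (\<lambda>s. \<rho> (t + s)) (lindblad_rhs m K H L \<gamma> (\<rho> (t + s))) (at s within {0..\<tau>})"
      by (rule has_mat_derivative_shift[OF solutionD(3)[OF sol ts(1)[OF s]]]) (use t in auto)
    thus "has_mat_derivative ?F (?D s) (at s within {0..\<tau>})"
      by (rule has_mat_derivative_diff[OF _ euler_step_derivative[OF R s], of _ _ m]) (use s \<rho>c R in auto)
  qed (use t in simp)
  hence step: "dual_norm m (?F \<tau> - ?F 0) \<le> \<tau> * M * ?c" by (simp only: mult_ac)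
  have F0: "?F 0 = \<rho> t - R" by (simp add: euler_step_0[OF R])
  have \<tau>: "\<tau> \<in> {0..\<tau>}" using t by simp
  have "?F \<tau> = (?F \<tau> - ?F 0) + ?F 0"
    using \<rho>c[OF \<tau>] \<rho>t R carrier_matD[OF euler_step_carrier[OF R, of \<tau>]] unfolding F0 by (intro eq_matI) auto
  hence "dual_norm m (?F \<tau>) \<le> dual_norm m (?F \<tau> - ?F 0) + dual_norm m (?F 0)"
    using dual_norm_add[of "?F \<tau> - ?F 0" m "?F 0"] \<rho>c[OF \<tau>] \<rho>t R unfolding F0 by simp
  thus ?thesis using step unfolding F0 e_def by simp
qed

text \<open>The one-step estimate has the form \<open>e' \<le> (1 + \<tau> Q) e + \<tau>\<^sup>2 P\<close>, where one factor \<open>\<tau> \<le> T\<close> has been used to make \<open>Q\<close>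
  independent of \<open>\<tau>\<close>.  It sums to \<open>n \<tau>\<^sup>2 P (1 + \<tau> Q)\<^sup>n\<close>, and \<open>(1 + \<tau> Q)\<^sup>n \<le> exp (T Q)\<close>.\<close>
lemma global_error:
  assumes sol: "lindblad_solution m K H L \<gamma> T \<rho>\<^sub>0 \<rho>"
    and \<rho>0: "\<rho>\<^sub>0 \<in> carrier_mat m m" "mat_psd \<rho>\<^sub>0" "mat_trace \<rho>\<^sub>0 = 1"
    and T: "0 < T" "0 < N" and \<tau>: "\<tau> = T / real N"
    and num: "\<rho>num 0 = \<rho>\<^sub>0" "\<And>n. n < N \<Longrightarrow> \<rho>num (Suc n) = euler_step \<tau> (\<rho>num n)"
    and n: "n \<le> N"
  shows "\<rho>num n \<in> carrier_mat m m" (is ?car)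
    and "dual_norm m (\<rho> (real n * \<tau>) - \<rho>num n)
      \<le> M\<^sup>2 * B * (1 + B) * exp (T * (M + T * M\<^sup>2 * B)) * (real n * \<tau>) * \<tau>" (is ?err)
proof -
  define Q where "Q = M + T * M\<^sup>2 * B"
  define P where "P = M\<^sup>2 * B * (1 + B)"
  have B0: "0 < B" by (simp add: B)
  have Q0: "0 \<le> Q" and P0: "0 \<le> P" using B0 T M by (auto simp: Q_def P_def)
  have \<tau>0: "0 \<le> \<tau>" and \<tau>T: "\<tau> \<le> T" using T by (auto simp: \<tau> field_simps)
  have time: "real k * \<tau> \<le> T" if "k \<le> N" for k using that T by (simp add: \<tau> field_simps)
  have *: "\<rho>num n \<in> carrier_mat m m \<and>
    dual_norm m (\<rho> (real n * \<tau>) - \<rho>num n) \<le> real n * (\<tau>\<^sup>2 * P) * (1 + \<tau> * Q) ^ n"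
    using n
  proof (induction n)
    case 0
    have "\<rho>\<^sub>0 - \<rho>\<^sub>0 = 0\<^sub>m m m" using \<rho>0 by (intro eq_matI) auto
    thus ?case using \<rho>0 num solutionD(1)[OF sol] dual_norm_zero[of m] by simp
  next
    case (Suc n)
    hence c: "\<rho>num n \<in> carrier_mat m m"
      and IH: "dual_norm m (\<rho> (real n * \<tau>) - \<rho>num n) \<le> real n * (\<tau>\<^sup>2 * P) * (1 + \<tau> * Q) ^ n" by auto
    define e where "e = dual_norm m (\<rho> (real n * \<tau>) - \<rho>num n)"
    have "\<rho> (real n * \<tau>) \<in> carrier_mat m m"
      using solutionD(2)[OF sol, of "real n * \<tau>"] time[of n] Suc \<tau>0 by simp
    hence e0: "0 \<le> e" unfolding e_def using c by (intro dual_norm_nonneg) simp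
    have st: "real (Suc n) * \<tau> = real n * \<tau> + \<tau>" by (simp add: algebra_simps)
    have tn: "real n * \<tau> + \<tau> \<le> T" unfolding st[symmetric] using Suc.prems by (rule time)
    have pow1: "1 \<le> (1 + \<tau> * Q) ^ Suc n" using \<tau>0 Q0 by (intro one_le_power) simp
    have "dual_norm m (\<rho> (real (Suc n) * \<tau>) - \<rho>num (Suc n))
        \<le> e + \<tau> * M * (\<tau> * M * B + e + \<tau> * M * (B * (B + e)))"
      unfolding st e_def using one_step_error[OF sol \<rho>0(2,3) _ \<tau>0 _ c, of "real n * \<tau>"]
        tn Suc.prems \<tau>0 num(2)[of n] by simp
    also have "\<dots> = e * (1 + \<tau> * (M + \<tau> * M\<^sup>2 * B)) + \<tau>\<^sup>2 * P"
      by (simp add: P_def power2_eq_square algebra_simps)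
    also have "\<dots> \<le> e * (1 + \<tau> * Q) + \<tau>\<^sup>2 * P"
      unfolding Q_def using \<tau>0 \<tau>T B0 M e0
      by (intro add_right_mono mult_left_mono add_left_mono mult_right_mono) auto
    also have "\<dots> \<le> real n * (\<tau>\<^sup>2 * P) * (1 + \<tau> * Q) ^ n * (1 + \<tau> * Q) + \<tau>\<^sup>2 * P * (1 + \<tau> * Q) ^ Suc n"
    proof (rule add_mono)
      show "e * (1 + \<tau> * Q) \<le> real n * (\<tau>\<^sup>2 * P) * (1 + \<tau> * Q) ^ n * (1 + \<tau> * Q)"
        using IH \<tau>0 Q0 unfolding e_def[symmetric] by (intro mult_right_mono) auto
      show "\<tau>\<^sup>2 * P \<le> \<tau>\<^sup>2 * P * (1 + \<tau> * Q) ^ Suc n"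
        using mult_left_mono[OF pow1, of "\<tau>\<^sup>2 * P"] P0 by simp
    qed
    also have "\<dots> = real (Suc n) * (\<tau>\<^sup>2 * P) * (1 + \<tau> * Q) ^ Suc n" by (simp add: algebra_simps)
    finally show ?case using c num(2)[of n] Suc.prems by simp
  qed
  thus ?car by simp
  have "(1 + \<tau> * Q) ^ n \<le> exp (\<tau> * Q) ^ n"
    using \<tau>0 Q0 by (intro power_mono exp_ge_add_one_self) auto
  also have "\<dots> = exp (real n * \<tau> * Q)" by (simp add: exp_of_nat_mult[symmetric] mult_ac)
  also have "\<dots> \<le> exp (T * Q)" using time[OF n] Q0 by (simp add: mult_right_mono)
  finally have "real n * (\<tau>\<^sup>2 * P) * (1 + \<tau> * Q) ^ n \<le> real n * (\<tau>\<^sup>2 * P) * exp (T * Q)"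
    using P0 by (intro mult_left_mono) auto
  with * have "dual_norm m (\<rho> (real n * \<tau>) - \<rho>num n) \<le> real n * (\<tau>\<^sup>2 * P) * exp (T * Q)"
    by linarith
  thus ?err by (simp add: P_def Q_def power2_eq_square mult_ac)
qed

end

end

section \<open>The convergence theorem\<close>

theorem theorem4p4:
  shows "\<exists>c\<^sub>1 :: real \<Rightarrow> real \<Rightarrow> real \<Rightarrow> real.
    (\<forall>C\<^sub>1 C\<^sub>2 T. 0 < c\<^sub>1 C\<^sub>1 C\<^sub>2 T) \<and>
    (\<forall>(m::nat) (K::nat) (N::nat) (T::real) (\<tau>::real) (H::complex mat) (L::nat \<Rightarrow> complex mat)
       (\<gamma>::nat \<Rightarrow> real) (C\<^sub>1::real) (C\<^sub>2::real) (\<rho>\<^sub>0::complex mat)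
       (\<rho>::real \<Rightarrow> complex mat) (\<rho>num::nat \<Rightarrow> complex mat).
      0 < m \<longrightarrow> 0 < K \<longrightarrow> 0 < N \<longrightarrow> 0 < T \<longrightarrow> \<tau> = T / real N \<longrightarrow>
      H \<in> carrier_mat m m \<longrightarrow> mat_hermitian H \<longrightarrow>
      (\<forall>k\<in>{1..K}. L k \<in> carrier_mat m m) \<longrightarrow>
      (\<forall>k\<in>{1..K}. 0 \<le> \<gamma> k) \<longrightarrow>
      C\<^sub>1 = (\<Sum>k=1..K. \<gamma> k * (trace_norm (L k))\<^sup>2) \<longrightarrow>
      C\<^sub>2 = trace_norm (drift m K H L \<gamma>) \<longrightarrow>
      \<rho>\<^sub>0 \<in> carrier_mat m m \<longrightarrow> mat_hermitian \<rho>\<^sub>0 \<longrightarrow> mat_psd \<rho>\<^sub>0 \<longrightarrow> mat_trace \<rho>\<^sub>0 = 1 \<longrightarrow>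
      lindblad_solution m K H L \<gamma> T \<rho>\<^sub>0 \<rho> \<longrightarrow>
      \<rho>num 0 = \<rho>\<^sub>0 \<longrightarrow>
      (\<forall>n<N. \<rho>num (Suc n) = exp_euler_step m K H L \<gamma> \<tau> (\<rho>num n)) \<longrightarrow>
      (\<forall>n\<le>N. trace_norm (\<rho> (real n * \<tau>) - \<rho>num n) \<le> c\<^sub>1 C\<^sub>1 C\<^sub>2 T * (real n * \<tau>) * \<tau>))"
proof -
  \<comment> \<open>Absolute values and the summand 1 make the constant positive for all real arguments, including those
    that do not come from an equation.\<close>
  define M :: "real \<Rightarrow> real \<Rightarrow> real" where "M C\<^sub>1 C\<^sub>2 = 2 * \<bar>C\<^sub>2\<bar> + \<bar>C\<^sub>1\<bar> + 1" for C\<^sub>1 C\<^sub>2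
  define B where "B C\<^sub>1 C\<^sub>2 T = 2 * exp (2 * M C\<^sub>1 C\<^sub>2 * T)" for C\<^sub>1 C\<^sub>2 T
  define c where "c C\<^sub>1 C\<^sub>2 T = (M C\<^sub>1 C\<^sub>2)\<^sup>2 * B C\<^sub>1 C\<^sub>2 T * (1 + B C\<^sub>1 C\<^sub>2 T)
    * exp (T * (M C\<^sub>1 C\<^sub>2 + T * (M C\<^sub>1 C\<^sub>2)\<^sup>2 * B C\<^sub>1 C\<^sub>2 T))" for C\<^sub>1 C\<^sub>2 T
  have M0: "0 < M C\<^sub>1 C\<^sub>2" for C\<^sub>1 C\<^sub>2 by (simp add: M_def)
  have B0: "0 < B C\<^sub>1 C\<^sub>2 T" for C\<^sub>1 C\<^sub>2 T by (simp add: B_def)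
  have c0: "\<forall>C\<^sub>1 C\<^sub>2 T. 0 < c C\<^sub>1 C\<^sub>2 T"
    using M0 B0 by (auto simp: c_def intro!: mult_pos_pos add_pos_pos zero_less_power)
  show ?thesis
  proof (rule exI[of _ c], intro conjI allI impI)
    show "0 < c C\<^sub>1 C\<^sub>2 T" for C\<^sub>1 C\<^sub>2 T using c0 by blast
  next
    fix m K N :: nat and T \<tau> :: real and H :: "complex mat" and L :: "nat \<Rightarrow> complex mat"
      and \<gamma> :: "nat \<Rightarrow> real" and C\<^sub>1 C\<^sub>2 :: real and \<rho>\<^sub>0 :: "complex mat"
      and \<rho> :: "real \<Rightarrow> complex mat" and \<rho>num :: "nat \<Rightarrow> complex mat" and n :: nat
    assume N: "0 < N" and T: "0 < T" and \<tau>: "\<tau> = T / real N"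
      and H: "H \<in> carrier_mat m m" "mat_hermitian H"
      and L: "\<forall>k\<in>{1..K}. L k \<in> carrier_mat m m" and \<gamma>: "\<forall>k\<in>{1..K}. 0 \<le> \<gamma> k"
      and C1: "C\<^sub>1 = (\<Sum>k=1..K. \<gamma> k * (trace_norm (L k))\<^sup>2)"
      and C2: "C\<^sub>2 = trace_norm (drift m K H L \<gamma>)"
      and \<rho>0: "\<rho>\<^sub>0 \<in> carrier_mat m m" "mat_psd \<rho>\<^sub>0" "mat_trace \<rho>\<^sub>0 = 1"
      and sol: "lindblad_solution m K H L \<gamma> T \<rho>\<^sub>0 \<rho>"
      and num: "\<rho>num 0 = \<rho>\<^sub>0" "\<forall>n<N. \<rho>num (Suc n) = exp_euler_step m K H L \<gamma> \<tau> (\<rho>num n)"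
      and n: "n \<le> N"
    interpret lindblad_data m K H L \<gamma> using H L \<gamma> by unfold_locales auto
    have C: "lindblad_data.C\<^sub>1 K L \<gamma> = C\<^sub>1" "lindblad_data.C\<^sub>2 m K H L \<gamma> = C\<^sub>2"
      by (simp_all add: C\<^sub>1_def C\<^sub>2_def C1 C2)
    have MC: "2 * lindblad_data.C\<^sub>2 m K H L \<gamma> + lindblad_data.C\<^sub>1 K L \<gamma> \<le> M C\<^sub>1 C\<^sub>2"
      unfolding C by (simp add: M_def)
    have num': "\<And>k. k < N \<Longrightarrow> \<rho>num (Suc k) = exp_euler_step m K H L \<gamma> \<tau> (\<rho>num k)" using num(2) by blast
    note err = global_error[OF M0 MC B_def sol \<rho>0 T N \<tau> num(1) num' n]
    have "real n * \<tau> \<in> {0..T}" using n T N by (auto simp: \<tau> field_simps)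
    hence "\<rho> (real n * \<tau>) - \<rho>num n \<in> carrier_mat m m" using solutionD(2)[OF sol] err(1) by simp
    from order_trans[OF trace_norm_le_dual_norm[OF this] err(2)]
    show "trace_norm (\<rho> (real n * \<tau>) - \<rho>num n) \<le> c C\<^sub>1 C\<^sub>2 T * (real n * \<tau>) * \<tau>"
      unfolding c_def .
  qed
qed

end
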